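(* Let $\Gamma$ be a simplicial graph and $\mathcal{G}=\{G_v\}_{v\in V(\Gamma)}$ a collection of non-trivial groups. Let $X$ be the Cayley graph of the graph product $\Gamma\mathcal{G}$ with respect to the generating set $\bigsqcup_{v\in V(\Gamma)}(G_v\setminus\{1\})$. Then there exists a $\Gamma\mathcal{G}$-equivariant bijection $F:V(\Gamma^e)\to\mathcal{H}(X)$ from the vertex set of the extension graph to the set of hyperplanes of $X$ such that $F$ is a graph isomorphism from the extension graph $\Gamma^e$ to the crossing graph $\Delta X$, and also a graph isomorphism from the coned-off extension graph $\widehat{\Gamma}^e$ to the contact graph $\mathcal{C}X$.
   Context: Graphs are simplicial (no loops, no multiple edges). Graph product: $\Gamma\mathcal{G}$ is the quotient of the free product $\ast_{v\in V(\Gamma)}G_v$ by the normal subgroup generated by all commutators $[g_v,g_w]$ with $(v,w)\in E(\Gamma)$, $g_v\in G_v$, $g_w\in G_w$. Each $G_v$ is identified with a subgroup of $\Gamma\mathcal{G}$. Extension graph $\Gamma^e$: its vertices are the subgroups $gG_vg^{-1}$ of $\Gamma\mathcal{G}$ ($v\in V(\Gamma)$, $g\in\Gamma\mathcal{G}$), and two distinct vertices are adjacent iff they commute elementwise. $\Gamma\mathcal{G}$ acts on $\Gamma^e$ by conjugation, $g.x=gxg^{-1}$. The map $v\mapsto G_v$ identifies $\Gamma$ with an induced subgraph of $\Gamma^e$, and $g.\Gamma$ denotes its translate by $g$. Coned-off extension graph $\widehat{\Gamma}^e$: $V(\widehat{\Gamma}^e)=V(\Gamma^e)$, and two distinct vertices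 $x,y$ are adjacent iff there is $g\in\Gamma\mathcal{G}$ with $\{x,y\}\subset V(g.\Gamma)$. The graph $X$ is known to be a quasi-median graph; $\Gamma\mathcal{G}$ acts on it by left multiplication, hence on its hyperplanes. A square in $X$ is an induced subgraph isomorphic to a circuit of length 4. A hyperplane of $X$ is an equivalence class of (unoriented) edges of $X$, where two edges $e,f$ are equivalent if there is a sequence of edges $e=e_0,\dots,e_n=f$ such that for every $0\le i\le n-1$, $e_i$ and $e_{i+1}$ are either two sides of a triangle or opposite sides of a square. $\mathcal{H}(X)$ is the set of hyperplanes. For $J\in\mathcal{H}(X)$, $N'(J)$ is the set of endpoints of all edges in $J$. The crossing graph $\Delta X$ has vertex set $\mathcal{H}(X)$, with distinct $J_1,J_2$ adjacent iff some square of $X$ contains both an edge of $J_1$ and an edge of $J_2$. The contact graph $\mathcal{C}X$ has vertex set $\mathcal{H}(X)$, with distinct $J_1,J_2$ adjacent iff $N'(J_1)\cap N'(J_2)\ne\emptyset$. *)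

theory Defs
  imports "HOL-Algebra.Coset"
begin

section \<open>Simplicial graphs\<close>

text \<open>
  Graphs may be infinite. An (unoriented) edge is the two-element set of its endpoints.
\<close>

record 'a sgraph =
  verts :: "'a set"
  edges :: "'a set set"

definition simplicial_graph :: "'a sgraph \<Rightarrow> bool" where
  "simplicial_graph X \<longleftrightarrow>
     (\<forall>e\<in>edges X. \<exists>x\<in>verts X. \<exists>y\<in>verts X. x \<noteq> y \<and> e = {x, y})"

definition graph_isomorphism :: "('a \<Rightarrow> 'b) \<Rightarrow> 'a sgraph \<Rightarrow> 'b sgraph \<Rightarrow> bool" where
  "graph_isomorphism f X Y \<longleftrightarrow>
     bij_betw f (verts X) (verts Y) \<and>
     (\<forall>x\<in>verts X. \<forall>y\<in>verts X. {x, y} \<in> edges X \<longleftrightarrow> {f x, f y} \<in> edges Y)"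

definition induced_subgraph :: "'a sgraph \<Rightarrow> 'a set \<Rightarrow> 'a sgraph" where
  "induced_subgraph X U = \<lparr>verts = U, edges = {e \<in> edges X. e \<subseteq> U}\<rparr>"

definition circuit :: "nat \<Rightarrow> nat sgraph" where
  "circuit n = \<lparr>verts = {..<n}, edges = {{i, Suc i mod n} | i. i < n}\<rparr>"

definition induced_circuit :: "nat \<Rightarrow> 'a sgraph \<Rightarrow> 'a set \<Rightarrow> bool" where
  "induced_circuit n X U \<longleftrightarrow>
     U \<subseteq> verts X \<and> (\<exists>f. graph_isomorphism f (circuit n) (induced_subgraph X U))"

abbreviation triangle :: "'a sgraph \<Rightarrow> 'a set \<Rightarrow> bool" where
  "triangle \<equiv> induced_circuit 3"

abbreviation square :: "'a sgraph \<Rightarrow> 'a set \<Rightarrow> bool" where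
  "square \<equiv> induced_circuit 4"

abbreviation sides :: "'a sgraph \<Rightarrow> 'a set \<Rightarrow> 'a set set" where
  "sides X U \<equiv> edges (induced_subgraph X U)"


section \<open>Hyperplanes, crossing graph and contact graph\<close>

text \<open>Two sides of a square are opposite iff they are disjoint.\<close>

definition elementary_parallel :: "'a sgraph \<Rightarrow> 'a set rel" where
  "elementary_parallel X =
     {(e, f). \<exists>T. triangle X T \<and> e \<in> sides X T \<and> f \<in> sides X T} \<union>
     {(e, f). \<exists>Q. square X Q \<and> e \<in> sides X Q \<and> f \<in> sides X Q \<and> e \<inter> f = {}}"

definition hyperplanes :: "'a sgraph \<Rightarrow> 'a set set set" where
  "hyperplanes X = edges X // (elementary_parallel X)\<^sup>*"

text \<open>The set \<open>N'(J)\<close> of endpoints of the edges in \<open>J\<close>.\<close>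

definition hyperplane_endpoints :: "'a set set \<Rightarrow> 'a set" where
  "hyperplane_endpoints J = \<Union>J"

definition crossing_graph :: "'a sgraph \<Rightarrow> 'a set set sgraph" where
  "crossing_graph X =
     \<lparr>verts = hyperplanes X,
      edges = {{J, K} | J K. J \<in> hyperplanes X \<and> K \<in> hyperplanes X \<and> J \<noteq> K \<and>
                 (\<exists>Q. square X Q \<and> sides X Q \<inter> J \<noteq> {} \<and> sides X Q \<inter> K \<noteq> {})}\<rparr>"

definition contact_graph :: "'a sgraph \<Rightarrow> 'a set set sgraph" where
  "contact_graph X =
     \<lparr>verts = hyperplanes X,
      edges = {{J, K} | J K. J \<in> hyperplanes X \<and> K \<in> hyperplanes X \<and> J \<noteq> K \<and>
                 hyperplane_endpoints J \<inter> hyperplane_endpoints K \<noteq> {}}\<rparr>"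


section \<open>Free products\<close>

text \<open>
  The free product of the family \<open>G\<close> over the index set \<open>V\<close> consists of the words in the disjoint
  union of the groups modulo the congruence generated by deleting a letter that is an identity
  element and multiplying two adjacent letters from the same group.
\<close>

definition words :: "'v set \<Rightarrow> ('v \<Rightarrow> ('g, 'b) monoid_scheme) \<Rightarrow> ('v \<times> 'g) list set" where
  "words V G = lists (SIGMA v:V. carrier (G v))"

inductive_set word_rel :: "'v set \<Rightarrow> ('v \<Rightarrow> ('g, 'b) monoid_scheme) \<Rightarrow> ('v \<times> 'g) list rel"
  for V :: "'v set" and G :: "'v \<Rightarrow> ('g, 'b) monoid_scheme" where
  refl: "x \<in> words V G \<Longrightarrow> (x, x) \<in> word_rel V G"
| sym: "(x, y) \<in> word_rel V G \<Longrightarrow> (y, x) \<in> word_rel V G"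
| trans: "(x, y) \<in> word_rel V G \<Longrightarrow> (y, z) \<in> word_rel V G \<Longrightarrow> (x, z) \<in> word_rel V G"
| one: "x \<in> words V G \<Longrightarrow> y \<in> words V G \<Longrightarrow> v \<in> V \<Longrightarrow>
    (x @ [(v, \<one>\<^bsub>G v\<^esub>)] @ y, x @ y) \<in> word_rel V G"
| mult: "x \<in> words V G \<Longrightarrow> y \<in> words V G \<Longrightarrow> v \<in> V \<Longrightarrow>
    g \<in> carrier (G v) \<Longrightarrow> h \<in> carrier (G v) \<Longrightarrow>
    (x @ [(v, g), (v, h)] @ y, x @ [(v, g \<otimes>\<^bsub>G v\<^esub> h)] @ y) \<in> word_rel V G"

definition free_product ::
    "'v set \<Rightarrow> ('v \<Rightarrow> ('g, 'b) monoid_scheme) \<Rightarrow> ('v \<times> 'g) list set monoid" where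
  "free_product V G =
     \<lparr>carrier = words V G // word_rel V G,
      mult = (\<lambda>A B. \<Union>a\<in>A. \<Union>b\<in>B. word_rel V G `` {a @ b}),
      one = word_rel V G `` {[]}\<rparr>"

definition free_product_incl ::
    "'v set \<Rightarrow> ('v \<Rightarrow> ('g, 'b) monoid_scheme) \<Rightarrow> 'v \<Rightarrow> 'g \<Rightarrow> ('v \<times> 'g) list set" where
  "free_product_incl V G v g = word_rel V G `` {[(v, g)]}"


section \<open>Graph products\<close>

definition normal_closure :: "('a, 'b) monoid_scheme \<Rightarrow> 'a set \<Rightarrow> 'a set" where
  "normal_closure P S = \<Inter>{N. N \<lhd> P \<and> S \<subseteq> N}"

definition commutator :: "('a, 'b) monoid_scheme \<Rightarrow> 'a \<Rightarrow> 'a \<Rightarrow> 'a" where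
  "commutator P a b = a \<otimes>\<^bsub>P\<^esub> b \<otimes>\<^bsub>P\<^esub> inv\<^bsub>P\<^esub> a \<otimes>\<^bsub>P\<^esub> inv\<^bsub>P\<^esub> b"

definition graph_product_kernel ::
    "'v sgraph \<Rightarrow> ('v \<Rightarrow> ('g, 'b) monoid_scheme) \<Rightarrow> ('v \<times> 'g) list set set" where
  "graph_product_kernel \<Gamma> G =
     normal_closure (free_product (verts \<Gamma>) G)
       {commutator (free_product (verts \<Gamma>) G)
          (free_product_incl (verts \<Gamma>) G v g) (free_product_incl (verts \<Gamma>) G w h) | v w g h.
        v \<in> verts \<Gamma> \<and> w \<in> verts \<Gamma> \<and> {v, w} \<in> edges \<Gamma> \<and> g \<in> carrier (G v) \<and> h \<in> carrier (G w)}"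

definition graph_product ::
    "'v sgraph \<Rightarrow> ('v \<Rightarrow> ('g, 'b) monoid_scheme) \<Rightarrow> ('v \<times> 'g) list set set monoid" where
  "graph_product \<Gamma> G = free_product (verts \<Gamma>) G Mod graph_product_kernel \<Gamma> G"

text \<open>The subgroup of the graph product with which \<open>G v\<close> is identified.\<close>

definition vertex_group ::
    "'v sgraph \<Rightarrow> ('v \<Rightarrow> ('g, 'b) monoid_scheme) \<Rightarrow> 'v \<Rightarrow> ('v \<times> 'g) list set set set" where
  "vertex_group \<Gamma> G v =
     (\<lambda>g. graph_product_kernel \<Gamma> G #>\<^bsub>free_product (verts \<Gamma>) G\<^esub> free_product_incl (verts \<Gamma>) G v g)
       ` carrier (G v)"

definition graph_product_generators ::
    "'v sgraph \<Rightarrow> ('v \<Rightarrow> ('g, 'b) monoid_scheme) \<Rightarrow> ('v \<times> 'g) list set set set" where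
  "graph_product_generators \<Gamma> G =
     (\<Union>v\<in>verts \<Gamma>. vertex_group \<Gamma> G v - {\<one>\<^bsub>graph_product \<Gamma> G\<^esub>})"

text \<open>Edges join \<open>p\<close> to \<open>p s\<close>, so that left multiplication acts by graph automorphisms.\<close>

definition cayley_graph :: "('a, 'b) monoid_scheme \<Rightarrow> 'a set \<Rightarrow> 'a sgraph" where
  "cayley_graph P S =
     \<lparr>verts = carrier P, edges = {{p, p \<otimes>\<^bsub>P\<^esub> s} | p s. p \<in> carrier P \<and> s \<in> S}\<rparr>"

text \<open>The action on sets of edges (in particular on hyperplanes) induced by left multiplication.\<close>

definition left_translate :: "('a, 'b) monoid_scheme \<Rightarrow> 'a \<Rightarrow> 'a set set \<Rightarrow> 'a set set" where
  "left_translate P p J = (\<lambda>e. p <#\<^bsub>P\<^esub> e) ` J"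


section \<open>Extension graphs\<close>

definition conjugate :: "('a, 'b) monoid_scheme \<Rightarrow> 'a \<Rightarrow> 'a set \<Rightarrow> 'a set" where
  "conjugate P p H = p <#\<^bsub>P\<^esub> (H #>\<^bsub>P\<^esub> inv\<^bsub>P\<^esub> p)"

text \<open>The vertex set of the translate \<open>p.\<Gamma>\<close>, where a vertex \<open>v\<close> of \<open>\<Gamma>\<close> is identified with the
  vertex group of \<open>v\<close>.\<close>

definition translate_verts ::
    "'v sgraph \<Rightarrow> ('v \<Rightarrow> ('g, 'b) monoid_scheme) \<Rightarrow> ('v \<times> 'g) list set set \<Rightarrow>
     ('v \<times> 'g) list set set set set" where
  "translate_verts \<Gamma> G p = (\<lambda>v. conjugate (graph_product \<Gamma> G) p (vertex_group \<Gamma> G v)) ` verts \<Gamma>"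

definition extension_verts ::
    "'v sgraph \<Rightarrow> ('v \<Rightarrow> ('g, 'b) monoid_scheme) \<Rightarrow> ('v \<times> 'g) list set set set set" where
  "extension_verts \<Gamma> G =
     {conjugate (graph_product \<Gamma> G) p (vertex_group \<Gamma> G v) | p v.
        p \<in> carrier (graph_product \<Gamma> G) \<and> v \<in> verts \<Gamma>}"

definition extension_graph ::
    "'v sgraph \<Rightarrow> ('v \<Rightarrow> ('g, 'b) monoid_scheme) \<Rightarrow> ('v \<times> 'g) list set set set sgraph" where
  "extension_graph \<Gamma> G =
     \<lparr>verts = extension_verts \<Gamma> G,
      edges = {{A, B} | A B. A \<in> extension_verts \<Gamma> G \<and> B \<in> extension_verts \<Gamma> G \<and> A \<noteq> B \<and>
                 (\<forall>a\<in>A. \<forall>b\<in>B. a \<otimes>\<^bsub>graph_product \<Gamma> G\<^esub> b = b \<otimes>\<^bsub>graph_product \<Gamma> G\<^esub> a)}\<rparr>"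

definition coned_off_extension_graph ::
    "'v sgraph \<Rightarrow> ('v \<Rightarrow> ('g, 'b) monoid_scheme) \<Rightarrow> ('v \<times> 'g) list set set set sgraph" where
  "coned_off_extension_graph \<Gamma> G =
     \<lparr>verts = extension_verts \<Gamma> G,
      edges = {{A, B} | A B. A \<in> extension_verts \<Gamma> G \<and> B \<in> extension_verts \<Gamma> G \<and> A \<noteq> B \<and>
                 (\<exists>p\<in>carrier (graph_product \<Gamma> G). {A, B} \<subseteq> translate_verts \<Gamma> G p)}\<rparr>"

end

theory Submission
  imports Defs "HOL-Algebra.Generated_Groups"
begin

text \<open>
  Write \<open>P\<close> for the graph product and label an edge \<open>{p, p s}\<close> of the Cayley graph, with \<open>s \<noteq> 1\<close>
  in the vertex group of \<open>v\<close>, by the conjugate \<open>p G\<^sub>v p\<inverse>\<close>. The label is constant on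
  triangles, whose sides all carry elements of one vertex group, and on opposite sides of squares,
  because a square is spanned by elements of two commuting vertex groups. So a label is an invariant
  of hyperplanes, and the bijection sends the conjugate \<open>A\<close> to the set \<open>wall A\<close> of all edges with
  label \<open>A\<close>. What has to be shown is that each wall is a single hyperplane, that conjugates commuting
  elementwise come from one square, and that hyperplanes are in contact iff their labels are
  conjugates of vertex groups by a common element; the last point only reads off the labels at a vertex.

  All the combinatorics comes from one construction that replaces normal forms. For a vertex \<open>v\<close> let
  \<open>S\<close> be the parabolic subgroup of its star. The graph product acts on the right on
  \<open>G\<^sub>v \<times> P\<close>: a generator \<open>t\<close> multiplies the second component, and it multiplies the first
  component too if \<open>t \<in> G\<^sub>v\<close> and the second component lies in \<open>S\<close>. The defining relations hold
  because \<open>S\<close> is stable under right multiplication by \<open>G\<^sub>v\<close> and by the adjacent vertex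
  groups. The first component of the orbit of \<open>(1, 1)\<close> is the gate map \<open>gate v\<close>; geometrically it is
  the nearest-point projection to the clique \<open>G\<^sub>v\<close>. It is equivariant under left multiplication by
  \<open>G\<^sub>v\<close>, and along an edge from \<open>p\<close> it changes only if the edge carries an element of \<open>G\<^sub>v\<close> and
  \<open>p \<in> S\<close>.

  This yields two facts. If \<open>s g = g t\<close> with \<open>s \<in> G\<^sub>v - {1}\<close> and \<open>t \<in> G\<^sub>w\<close>, then comparing gates
  gives \<open>v = w\<close> and \<open>g \<in> S\<close> (\<open>intertwined_in_star\<close>); hence two edges with the same label differ by an
  element of \<open>S\<close> and are joined by a chain of triangles and squares (\<open>star_parallel\<close>). If
  \<open>q t q\<inverse>\<close> lies in the parabolic subgroup of \<open>U\<close> for some \<open>t \<in> G\<^sub>w - {1}\<close>, then the gate of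
  \<open>w\<close>, read relative to \<open>q\<close>, must change along a path inside that subgroup, so \<open>q\<close> factors through it
  (\<open>conjugate_in_parabolic\<close>); applied to the star of \<open>v\<close>, this brings two commuting conjugates to a
  common base point (\<open>commuting_conjugates\<close>).
\<close>

section \<open>Free products\<close>

locale group_family =
  fixes V :: "'v set" and G :: "'v \<Rightarrow> ('g, 'b) monoid_scheme"
  assumes is_group: "\<And>v. v \<in> V \<Longrightarrow> group (G v)"
begin

lemma append_in_words [simp]: "x @ y \<in> words V G \<longleftrightarrow> x \<in> words V G \<and> y \<in> words V G"
  by (auto simp: words_def)

lemma Nil_in_words [simp]: "[] \<in> words V G"
  by (simp add: words_def)

lemma Cons_in_words [simp]:
  "(v, g) # x \<in> words V G \<longleftrightarrow> v \<in> V \<and> g \<in> carrier (G v) \<and> x \<in> words V G"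
  by (auto simp: words_def)

lemma word_rel_words: "(x, y) \<in> word_rel V G \<Longrightarrow> x \<in> words V G \<and> y \<in> words V G"
  by (induction rule: word_rel.induct)
    (auto intro: monoid.one_closed monoid.m_closed group.is_monoid is_group)

lemma equiv_word_rel: "equiv (words V G) (word_rel V G)"
  by (intro equivI refl_onI symI transI)
    (auto intro: word_rel.refl word_rel.sym word_rel.trans dest: word_rel_words)

text \<open>
  The relation is closed under adjoining letters on both sides because its generating steps are;
  this makes it a congruence for concatenation.
\<close>

lemma word_rel_context:
  "(x, y) \<in> word_rel V G \<Longrightarrow> a \<in> words V G \<Longrightarrow> b \<in> words V G \<Longrightarrow>
     (a @ x @ b, a @ y @ b) \<in> word_rel V G"
proof (induction rule: word_rel.induct)
  case (one x y v)
  then show ?case using word_rel.one[of "a @ x" V G "y @ b" v] by simp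
next
  case (mult x y v g h)
  then show ?case using word_rel.mult[of "a @ x" V G "y @ b" v g h] by simp
qed (auto intro: word_rel.refl word_rel.sym word_rel.trans)

lemma word_rel_append:
  assumes "(x, x') \<in> word_rel V G" "(y, y') \<in> word_rel V G"
  shows "(x @ y, x' @ y') \<in> word_rel V G"
  using word_rel_context[OF assms(1), of "[]" y] word_rel_context[OF assms(2), of x' "[]"]
    assms[THEN word_rel_words] by (auto intro: word_rel.trans)

abbreviation word_class :: "('v \<times> 'g) list \<Rightarrow> ('v \<times> 'g) list set" where
  "word_class x \<equiv> word_rel V G `` {x}"

lemma word_class_eq_iff:
  "x \<in> words V G \<Longrightarrow> y \<in> words V G \<Longrightarrow> word_class x = word_class y \<longleftrightarrow> (x, y) \<in> word_rel V G"
  using eq_equiv_class_iff[OF equiv_word_rel] by simp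

lemma carrier_free_product: "carrier (free_product V G) = word_class ` words V G"
  by (auto simp: free_product_def quotient_def)

lemma word_class_closed [simp]:
  "x \<in> words V G \<Longrightarrow> word_class x \<in> carrier (free_product V G)"
  by (simp add: carrier_free_product)

lemma one_free_product: "\<one>\<^bsub>free_product V G\<^esub> = word_class []"
  by (simp add: free_product_def)

lemma mult_free_product:
  assumes "x \<in> words V G" "y \<in> words V G"
  shows "word_class x \<otimes>\<^bsub>free_product V G\<^esub> word_class y = word_class (x @ y)"
proof -
  have "word_class (a @ b) = word_class (x @ y)" if "a \<in> word_class x" "b \<in> word_class y" for a b
  proof -
    have "(x @ y, a @ b) \<in> word_rel V G" using that by (intro word_rel_append) auto
    then show ?thesis using equiv_class_eq[OF equiv_word_rel] by metis
  qed
  moreover have "x \<in> word_class x" "y \<in> word_class y"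
    using assms by (auto intro: word_rel.refl)
  ultimately have "(\<Union>a\<in>word_class x. \<Union>b\<in>word_class y. word_class (a @ b)) = word_class (x @ y)"
    by (intro equalityI UN_least) (blast, blast)
  then show ?thesis by (simp add: free_product_def)
qed

lemma word_inverse:
  assumes "x \<in> words V G"
  shows "\<exists>y\<in>words V G. (y @ x, []) \<in> word_rel V G"
  using assms
proof (induction x)
  case Nil
  then show ?case by (auto intro!: bexI[of _ "[]"] word_rel.refl)
next
  case (Cons l x)
  obtain v g where l: "l = (v, g)" by fastforce
  then have v: "v \<in> V" and g: "g \<in> carrier (G v)" and x: "x \<in> words V G"
    using Cons.prems by auto
  interpret Gv: group "G v" using is_group[OF v] .
  obtain y where y: "y \<in> words V G" "(y @ x, []) \<in> word_rel V G" using Cons.IH x by blast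
  let ?y = "y @ [(v, inv\<^bsub>G v\<^esub> g)]"
  have "(y @ [(v, inv\<^bsub>G v\<^esub> g), (v, g)] @ x, y @ [(v, inv\<^bsub>G v\<^esub> g \<otimes>\<^bsub>G v\<^esub> g)] @ x) \<in> word_rel V G"
    using x y v g by (intro word_rel.mult) auto
  moreover have "(y @ [(v, inv\<^bsub>G v\<^esub> g \<otimes>\<^bsub>G v\<^esub> g)] @ x, y @ x) \<in> word_rel V G"
    using word_rel.one[of y V G x v] x y v g by simp
  ultimately have "(?y @ l # x, []) \<in> word_rel V G"
    using y(2) l by (auto intro: word_rel.trans)
  moreover have "?y \<in> words V G" using y v g by simp
  ultimately show ?case by blast
qed

lemma group_free_product: "group (free_product V G)"
proof (rule groupI)
  fix a b c
  assume "a \<in> carrier (free_product V G)" "b \<in> carrier (free_product V G)"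
    "c \<in> carrier (free_product V G)"
  then show "a \<otimes>\<^bsub>free_product V G\<^esub> b \<otimes>\<^bsub>free_product V G\<^esub> c =
      a \<otimes>\<^bsub>free_product V G\<^esub> (b \<otimes>\<^bsub>free_product V G\<^esub> c)"
    by (auto simp: carrier_free_product mult_free_product)
next
  fix a assume "a \<in> carrier (free_product V G)"
  then obtain x where x: "x \<in> words V G" "a = word_class x"
    by (auto simp: carrier_free_product)
  obtain y where y: "y \<in> words V G" "(y @ x, []) \<in> word_rel V G"
    using word_inverse[OF x(1)] by blast
  have "word_class y \<otimes>\<^bsub>free_product V G\<^esub> a = \<one>\<^bsub>free_product V G\<^esub>"
    using x y by (simp add: mult_free_product one_free_product word_class_eq_iff)
  then show "\<exists>b\<in>carrier (free_product V G). b \<otimes>\<^bsub>free_product V G\<^esub> a = \<one>\<^bsub>free_product V G\<^esub>"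
    using y by (metis word_class_closed)
next
  fix a b assume "a \<in> carrier (free_product V G)" "b \<in> carrier (free_product V G)"
  then obtain x y where "x \<in> words V G" "a = word_class x" "y \<in> words V G" "b = word_class y"
    by (auto simp: carrier_free_product)
  then show "a \<otimes>\<^bsub>free_product V G\<^esub> b \<in> carrier (free_product V G)"
    by (simp add: mult_free_product)
next
  show "\<one>\<^bsub>free_product V G\<^esub> \<in> carrier (free_product V G)"
    by (simp add: one_free_product)
next
  fix a assume "a \<in> carrier (free_product V G)"
  then obtain x where "x \<in> words V G" "a = word_class x"
    by (auto simp: carrier_free_product)
  then show "\<one>\<^bsub>free_product V G\<^esub> \<otimes>\<^bsub>free_product V G\<^esub> a = a"
    by (simp add: mult_free_product one_free_product)
qed

end

section \<open>Graph products\<close>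

lemma (in group) normal_normal_closure:
  assumes "S \<subseteq> carrier G"
  shows "normal_closure G S \<lhd> G"
proof -
  let ?F = "{N. N \<lhd> G \<and> S \<subseteq> N}"
  have "carrier G \<in> ?F" using assms normal_inv_iff subgroup_self by auto
  then have "subgroup (\<Inter>?F) G"
    by (intro subgroups_Inter) (auto dest: normal_imp_subgroup)
  then show ?thesis
    unfolding normal_closure_def by (auto simp: normal_inv_iff)
qed

lemma (in group) commutator_eq:
  "a \<in> carrier G \<Longrightarrow> b \<in> carrier G \<Longrightarrow> commutator G a b = a \<otimes> b \<otimes> inv (b \<otimes> a)"
  by (simp add: commutator_def inv_mult_group m_assoc)

lemma normal_closure_incl: "S \<subseteq> normal_closure P S"
  by (auto simp: normal_closure_def)

lemma normal_closure_least: "N \<lhd> P \<Longrightarrow> S \<subseteq> N \<Longrightarrow> normal_closure P S \<subseteq> N"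
  by (auto simp: normal_closure_def)

locale graph_of_groups = group_family "verts \<Gamma>" G
  for \<Gamma> :: "'v sgraph" and G :: "'v \<Rightarrow> ('g, 'b) monoid_scheme" +
  assumes simplicial: "simplicial_graph \<Gamma>"
begin

abbreviation FP where "FP \<equiv> free_product (verts \<Gamma>) G"
abbreviation K where "K \<equiv> graph_product_kernel \<Gamma> G"
abbreviation P where "P \<equiv> graph_product \<Gamma> G"

definition incl :: "'v \<Rightarrow> 'g \<Rightarrow> ('v \<times> 'g) list set set" where
  "incl v g = K #>\<^bsub>FP\<^esub> free_product_incl (verts \<Gamma>) G v g"

sublocale FP: group FP by (rule group_free_product)

lemma edge_verts: "{v, w} \<in> edges \<Gamma> \<Longrightarrow> v \<in> verts \<Gamma> \<and> w \<in> verts \<Gamma> \<and> v \<noteq> w"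
  using simplicial by (fastforce simp: simplicial_graph_def doubleton_eq_iff)

lemma free_product_incl_closed:
  "v \<in> verts \<Gamma> \<Longrightarrow> g \<in> carrier (G v) \<Longrightarrow> free_product_incl (verts \<Gamma>) G v g \<in> carrier FP"
  by (simp add: free_product_incl_def)

lemma normal_kernel: "K \<lhd> FP"
  unfolding graph_product_kernel_def
  by (rule FP.normal_normal_closure) (auto simp: commutator_def free_product_incl_closed)

sublocale K: normal K FP by (rule normal_kernel)

sublocale P: group P
  unfolding graph_product_def by (rule K.factorgroup_is_group)

lemma carrier_graph_product: "carrier P = (\<lambda>c. K #>\<^bsub>FP\<^esub> c) ` carrier FP"
  by (auto simp: graph_product_def FactGroup_def RCOSETS_def)

lemma one_graph_product: "\<one>\<^bsub>P\<^esub> = K"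
  by (simp add: graph_product_def FactGroup_def)

lemma coset_mult:
  "c \<in> carrier FP \<Longrightarrow> d \<in> carrier FP \<Longrightarrow>
     (K #>\<^bsub>FP\<^esub> c) \<otimes>\<^bsub>P\<^esub> (K #>\<^bsub>FP\<^esub> d) = K #>\<^bsub>FP\<^esub> (c \<otimes>\<^bsub>FP\<^esub> d)"
  by (simp add: graph_product_def FactGroup_def K.rcos_sum)

lemma incl_closed [simp]: "v \<in> verts \<Gamma> \<Longrightarrow> g \<in> carrier (G v) \<Longrightarrow> incl v g \<in> carrier P"
  by (simp add: incl_def carrier_graph_product free_product_incl_closed)

lemma incl_mult:
  assumes "v \<in> verts \<Gamma>" "g \<in> carrier (G v)" "h \<in> carrier (G v)"
  shows "incl v g \<otimes>\<^bsub>P\<^esub> incl v h = incl v (g \<otimes>\<^bsub>G v\<^esub> h)"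
proof -
  interpret Gv: group "G v" using is_group assms by blast
  have "word_class [(v, g), (v, h)] = word_class [(v, g \<otimes>\<^bsub>G v\<^esub> h)]"
    using word_rel.mult[of "[]" "verts \<Gamma>" G "[]" v g h] assms by (simp add: word_class_eq_iff)
  then show ?thesis
    using assms by (simp add: incl_def coset_mult free_product_incl_closed)
      (simp add: free_product_incl_def mult_free_product)
qed

lemma incl_one [simp]:
  assumes "v \<in> verts \<Gamma>" shows "incl v \<one>\<^bsub>G v\<^esub> = \<one>\<^bsub>P\<^esub>"
proof -
  interpret Gv: group "G v" using is_group assms by blast
  show ?thesis
    using assms incl_mult[of v "\<one>\<^bsub>G v\<^esub>" "\<one>\<^bsub>G v\<^esub>"] by simp
qed

lemma incl_inv:
  assumes "v \<in> verts \<Gamma>" "g \<in> carrier (G v)"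
  shows "inv\<^bsub>P\<^esub> (incl v g) = incl v (inv\<^bsub>G v\<^esub> g)"
proof -
  interpret Gv: group "G v" using is_group assms by blast
  show ?thesis using assms by (intro P.inv_equality) (auto simp: incl_mult)
qed

lemma incl_commute:
  assumes vw: "{v, w} \<in> edges \<Gamma>" and g: "g \<in> carrier (G v)" and h: "h \<in> carrier (G w)"
  shows "incl v g \<otimes>\<^bsub>P\<^esub> incl w h = incl w h \<otimes>\<^bsub>P\<^esub> incl v g"
proof -
  let ?a = "free_product_incl (verts \<Gamma>) G v g" and ?b = "free_product_incl (verts \<Gamma>) G w h"
  have cl: "?a \<in> carrier FP" "?b \<in> carrier FP"
    using edge_verts[OF vw] g h by (auto intro: free_product_incl_closed)
  have "commutator FP ?a ?b \<in> K"
    unfolding graph_product_kernel_def using edge_verts[OF vw] vw g h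
    by (intro subsetD[OF normal_closure_incl] CollectI exI[of _ v] exI[of _ w] exI[of _ g] exI[of _ h]
        conjI refl) auto
  then have "(K #>\<^bsub>FP\<^esub> commutator FP ?a ?b) #>\<^bsub>FP\<^esub> (?b \<otimes>\<^bsub>FP\<^esub> ?a) = K #>\<^bsub>FP\<^esub> (?b \<otimes>\<^bsub>FP\<^esub> ?a)"
    by (simp add: K.rcos_const[OF FP.is_group])
  then have "K #>\<^bsub>FP\<^esub> (commutator FP ?a ?b \<otimes>\<^bsub>FP\<^esub> (?b \<otimes>\<^bsub>FP\<^esub> ?a)) = K #>\<^bsub>FP\<^esub> (?b \<otimes>\<^bsub>FP\<^esub> ?a)"
    using cl by (simp add: FP.coset_mult_assoc[OF K.subset] FP.commutator_eq)
  moreover have "commutator FP ?a ?b \<otimes>\<^bsub>FP\<^esub> (?b \<otimes>\<^bsub>FP\<^esub> ?a) = ?a \<otimes>\<^bsub>FP\<^esub> ?b"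
    using cl by (simp add: FP.commutator_eq
        FP.m_assoc[of "?a \<otimes>\<^bsub>FP\<^esub> ?b" "inv\<^bsub>FP\<^esub> (?b \<otimes>\<^bsub>FP\<^esub> ?a)" "?b \<otimes>\<^bsub>FP\<^esub> ?a"])
  ultimately show ?thesis using cl by (simp add: incl_def coset_mult)
qed

text \<open>
  The graph product is generated as a monoid by the vertex groups, and a word grows at its right
  end, as a path in the Cayley graph does.
\<close>

lemma graph_product_induct [consumes 1, case_names one mult]:
  assumes "p \<in> carrier P"
    and one: "Q \<one>\<^bsub>P\<^esub>"
    and mult: "\<And>p v g. p \<in> carrier P \<Longrightarrow> v \<in> verts \<Gamma> \<Longrightarrow> g \<in> carrier (G v) \<Longrightarrow> Q p \<Longrightarrow>
                 Q (p \<otimes>\<^bsub>P\<^esub> incl v g)"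
  shows "Q p"
proof -
  obtain x where x: "x \<in> words (verts \<Gamma>) G" and p: "p = K #>\<^bsub>FP\<^esub> word_class x"
    using assms(1) by (auto simp: carrier_graph_product carrier_free_product)
  from x have "Q (K #>\<^bsub>FP\<^esub> word_class x)"
  proof (induction x rule: rev_induct)
    case Nil
    then show ?case
      using one by (simp add: one_graph_product flip: one_free_product)
        (metis FP.coset_mult_one K.subset)
  next
    case (snoc l x)
    obtain v g where l: "l = (v, g)" by fastforce
    have v: "x \<in> words (verts \<Gamma>) G" "v \<in> verts \<Gamma>" "g \<in> carrier (G v)" using snoc.prems l by auto
    have "(K #>\<^bsub>FP\<^esub> word_class x) \<otimes>\<^bsub>P\<^esub> incl v g = K #>\<^bsub>FP\<^esub> word_class (x @ [l])"
      using v l by (simp add: incl_def coset_mult free_product_incl_closed)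
        (simp add: free_product_incl_def mult_free_product)
    then show ?case
      using mult[of "K #>\<^bsub>FP\<^esub> word_class x" v g] snoc.IH v by (simp add: carrier_graph_product)
  qed
  then show ?thesis using p by simp
qed

text \<open>
  The universal property of the graph product, in the form of right actions. The words act by
  folding the action of the letters; the elements of the free product that act trivially form a
  normal subgroup containing the commutators, hence the kernel, so the action descends to the
  quotient.
\<close>

lemma right_action_extends:
  assumes closed: "\<And>x v g. x \<in> M \<Longrightarrow> v \<in> verts \<Gamma> \<Longrightarrow> g \<in> carrier (G v) \<Longrightarrow> act x (v, g) \<in> M"
    and act_one: "\<And>x v. x \<in> M \<Longrightarrow> v \<in> verts \<Gamma> \<Longrightarrow> act x (v, \<one>\<^bsub>G v\<^esub>) = x"
    and act_mult: "\<And>x v g h. x \<in> M \<Longrightarrow> v \<in> verts \<Gamma> \<Longrightarrow> g \<in> carrier (G v) \<Longrightarrow> h \<in> carrier (G v) \<Longrightarrow>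
          act (act x (v, g)) (v, h) = act x (v, g \<otimes>\<^bsub>G v\<^esub> h)"
    and act_commute: "\<And>x v w g h. x \<in> M \<Longrightarrow> {v, w} \<in> edges \<Gamma> \<Longrightarrow>
          g \<in> carrier (G v) \<Longrightarrow> h \<in> carrier (G w) \<Longrightarrow>
          act (act x (v, g)) (w, h) = act (act x (w, h)) (v, g)"
  obtains E where "\<And>x. x \<in> M \<Longrightarrow> E x \<one>\<^bsub>P\<^esub> = x"
    and "\<And>x p. x \<in> M \<Longrightarrow> p \<in> carrier P \<Longrightarrow> E x p \<in> M"
    and "\<And>x p v g. x \<in> M \<Longrightarrow> p \<in> carrier P \<Longrightarrow> v \<in> verts \<Gamma> \<Longrightarrow> g \<in> carrier (G v) \<Longrightarrow>
          E x (p \<otimes>\<^bsub>P\<^esub> incl v g) = act (E x p) (v, g)"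
proof -
  let ?A = "foldl act"
  have A_closed: "?A x w \<in> M" if "x \<in> M" "w \<in> words (verts \<Gamma>) G" for x w
    using that
  proof (induction w arbitrary: x)
    case (Cons l w)
    then show ?case using closed by (cases l) simp
  qed simp
  have A_rel: "?A x u = ?A x w" if "(u, w) \<in> word_rel (verts \<Gamma>) G" "x \<in> M" for x u w
    using that
  proof (induction arbitrary: x rule: word_rel.induct)
    case (one a b v)
    then show ?case using act_one[OF A_closed] by simp
  next
    case (mult a b v g h)
    then show ?case using act_mult[OF A_closed] by simp
  qed auto
  \<comment> \<open>The action of a class of words; by \<open>A_rel\<close> it can be read off from any representative.\<close>
  define B where "B x c = ?A x (SOME w. w \<in> c)" for x c
  have B_class: "B x (word_class w) = ?A x w" if "x \<in> M" "w \<in> words (verts \<Gamma>) G" for x w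
  proof -
    have "w \<in> word_class w" using that by (auto intro: word_rel.refl)
    then have "(SOME u. u \<in> word_class w) \<in> word_class w" by (rule someI)
    then show ?thesis using A_rel[of w _ x] that by (simp add: B_def)
  qed
  have B_closed: "B x c \<in> M" if "x \<in> M" "c \<in> carrier FP" for x c
    using that A_closed by (auto simp: carrier_free_product B_class)
  have B_mult: "B x (c \<otimes>\<^bsub>FP\<^esub> d) = B (B x c) d" if "x \<in> M" "c \<in> carrier FP" "d \<in> carrier FP" for x c d
    using that A_closed by (auto simp: carrier_free_product mult_free_product B_class)
  have B_one: "B x \<one>\<^bsub>FP\<^esub> = x" if "x \<in> M" for x
    using that by (simp add: one_free_product B_class)
  have B_cancel: "B (B x c) (inv\<^bsub>FP\<^esub> c) = x" if "x \<in> M" "c \<in> carrier FP" for x c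
    using that B_mult[of x c "inv\<^bsub>FP\<^esub> c"] by (simp add: B_one)
  \<comment> \<open>The elements of the free product that act trivially.\<close>
  define N where "N = {c \<in> carrier FP. \<forall>x\<in>M. B x c = x}"
  have "subgroup N FP"
  proof
    show "inv\<^bsub>FP\<^esub> c \<in> N" if "c \<in> N" for c
      using that B_cancel[of _ c] by (auto simp: N_def)
  qed (auto simp: N_def B_mult B_one)
  then have "N \<lhd> FP"
    by (auto simp: FP.normal_inv_iff N_def B_mult B_closed B_cancel)
  moreover have "commutator FP (free_product_incl (verts \<Gamma>) G v g)
      (free_product_incl (verts \<Gamma>) G w h) \<in> N"
    if "{v, w} \<in> edges \<Gamma>" "g \<in> carrier (G v)" "h \<in> carrier (G w)" for v w g h
  proof -
    let ?a = "free_product_incl (verts \<Gamma>) G v g" and ?b = "free_product_incl (verts \<Gamma>) G w h"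
    have vw: "v \<in> verts \<Gamma>" "w \<in> verts \<Gamma>" using edge_verts that by auto
    have cl: "?a \<in> carrier FP" "?b \<in> carrier FP"
      using vw that by (auto intro: free_product_incl_closed)
    have "B x (?a \<otimes>\<^bsub>FP\<^esub> ?b) = B x (?b \<otimes>\<^bsub>FP\<^esub> ?a)" if "x \<in> M" for x
      using that vw \<open>g \<in> _\<close> \<open>h \<in> _\<close> act_commute[OF _ \<open>{v, w} \<in> _\<close>]
      by (simp add: free_product_incl_def mult_free_product B_class)
    then have "B x (?a \<otimes>\<^bsub>FP\<^esub> ?b \<otimes>\<^bsub>FP\<^esub> inv\<^bsub>FP\<^esub> (?b \<otimes>\<^bsub>FP\<^esub> ?a)) = x" if "x \<in> M" for x
      using that cl B_cancel[of x "?b \<otimes>\<^bsub>FP\<^esub> ?a"]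
        B_mult[of x "?a \<otimes>\<^bsub>FP\<^esub> ?b" "inv\<^bsub>FP\<^esub> (?b \<otimes>\<^bsub>FP\<^esub> ?a)"] by simp
    then show ?thesis using cl by (simp add: N_def FP.commutator_eq)
  qed
  ultimately have "K \<subseteq> N"
    unfolding graph_product_kernel_def by (intro normal_closure_least) auto
  define E where "E x p = B x (SOME c. c \<in> p)" for x p
  have E_coset: "E x (K #>\<^bsub>FP\<^esub> c) = B x c" if "x \<in> M" "c \<in> carrier FP" for x c
  proof -
    have "c \<in> K #>\<^bsub>FP\<^esub> c" using that FP.rcos_self[OF _ K.is_subgroup] by blast
    then have "(SOME d. d \<in> K #>\<^bsub>FP\<^esub> c) \<in> K #>\<^bsub>FP\<^esub> c" by (rule someI)
    then obtain k where "k \<in> K" "(SOME d. d \<in> K #>\<^bsub>FP\<^esub> c) = k \<otimes>\<^bsub>FP\<^esub> c"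
      by (auto simp: r_coset_def)
    then show ?thesis
      using that \<open>K \<subseteq> N\<close> by (auto simp: E_def B_mult N_def subset_iff)
  qed
  show ?thesis
  proof (rule that[of E])
    show "E x \<one>\<^bsub>P\<^esub> = x" if "x \<in> M" for x
      using E_coset[OF that FP.one_closed] that
      by (simp add: one_graph_product B_one FP.coset_mult_one K.subset)
    show "E x p \<in> M" if "x \<in> M" "p \<in> carrier P" for x p
      using that by (auto simp: carrier_graph_product E_coset B_closed)
    show "E x (p \<otimes>\<^bsub>P\<^esub> incl v g) = act (E x p) (v, g)"
      if x: "x \<in> M" and p: "p \<in> carrier P" and v: "v \<in> verts \<Gamma>" and g: "g \<in> carrier (G v)" for x p v g
    proof -
      let ?a = "free_product_incl (verts \<Gamma>) G v g"
      obtain c where c: "c \<in> carrier FP" "p = K #>\<^bsub>FP\<^esub> c"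
        using p by (auto simp: carrier_graph_product)
      have a: "?a \<in> carrier FP" using v g by (rule free_product_incl_closed)
      have "E x (p \<otimes>\<^bsub>P\<^esub> incl v g) = B (B x c) ?a"
        using x c a by (simp add: incl_def coset_mult E_coset B_mult)
      also have "\<dots> = act (B x c) (v, g)"
        using B_class[of "B x c" "[(v, g)]"] B_closed[OF x c(1)] v g
        by (simp add: free_product_incl_def)
      finally show ?thesis using x c by (simp add: E_coset)
    qed
  qed
qed

end

section \<open>Parabolic subgroups\<close>

lemma (in group) conjugate_eq:
  "conjugate G p H = {p \<otimes> h \<otimes> inv p | h. h \<in> H}" if "p \<in> carrier G" "H \<subseteq> carrier G"
proof -
  have "p \<otimes> (h \<otimes> inv p) = p \<otimes> h \<otimes> inv p" if "h \<in> H" for h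
    using that \<open>p \<in> _\<close> \<open>H \<subseteq> _\<close> by (simp add: m_assoc subset_iff)
  then show ?thesis
    by (auto simp: conjugate_def l_coset_def r_coset_def)
qed

lemma (in group) conjugate_mult:
  assumes "p \<in> carrier G" "q \<in> carrier G" "H \<subseteq> carrier G"
  shows "conjugate G p (conjugate G q H) = conjugate G (p \<otimes> q) H"
proof -
  have "p \<otimes> (q \<otimes> h \<otimes> inv q) \<otimes> inv p = p \<otimes> q \<otimes> h \<otimes> inv (p \<otimes> q)" if "h \<in> H" for h
    using that assms by (auto simp: m_assoc inv_mult_group subset_iff)
  moreover have "conjugate G q H \<subseteq> carrier G"
    using assms by (auto simp: conjugate_eq subset_iff)
  ultimately show ?thesis
    using assms by (simp add: conjugate_eq) (metis (no_types, lifting))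
qed

lemma (in group) conjugate_one: "H \<subseteq> carrier G \<Longrightarrow> conjugate G \<one> H = H"
  by (force simp: conjugate_eq subset_iff)

context graph_of_groups
begin

definition parabolic :: "'v set \<Rightarrow> ('v \<times> 'g) list set set set" where
  "parabolic U = generate P (\<Union>w\<in>U. vertex_group \<Gamma> G w)"

definition star :: "'v \<Rightarrow> 'v set" where
  "star v = insert v {w. {v, w} \<in> edges \<Gamma>}"

lemma vertex_group_eq: "vertex_group \<Gamma> G v = incl v ` carrier (G v)"
  by (simp add: vertex_group_def incl_def)

lemma vertex_group_closed: "v \<in> verts \<Gamma> \<Longrightarrow> vertex_group \<Gamma> G v \<subseteq> carrier P"
  by (auto simp: vertex_group_eq)

lemma star_self [simp]: "v \<in> star v"
  by (simp add: star_def)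

lemma star_subset [simp]: "v \<in> verts \<Gamma> \<Longrightarrow> star v \<subseteq> verts \<Gamma>"
  using edge_verts by (auto simp: star_def)

lemma subgroup_parabolic:
  assumes "U \<subseteq> verts \<Gamma>"
  shows "subgroup (parabolic U) P"
  unfolding parabolic_def
proof (rule P.generate_is_subgroup, rule UN_least)
  show "vertex_group \<Gamma> G w \<subseteq> carrier P" if "w \<in> U" for w
    using that assms by (intro vertex_group_closed) blast
qed

lemma parabolic_closed: "U \<subseteq> verts \<Gamma> \<Longrightarrow> p \<in> parabolic U \<Longrightarrow> p \<in> carrier P"
  by (rule subgroup.mem_carrier[OF subgroup_parabolic])

lemma parabolic_one [simp]: "\<one>\<^bsub>P\<^esub> \<in> parabolic U"
  by (simp add: parabolic_def generate.one)

lemma incl_in_parabolic: "w \<in> U \<Longrightarrow> g \<in> carrier (G w) \<Longrightarrow> incl w g \<in> parabolic U"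
  unfolding parabolic_def by (rule generate.incl) (auto simp: vertex_group_eq)

text \<open>
  Inverses of generators are generators again, so induction over a parabolic subgroup needs no case
  for them.
\<close>

lemma parabolic_induct [consumes 2, case_names one incl mult]:
  assumes "U \<subseteq> verts \<Gamma>" "p \<in> parabolic U"
    and one: "Q \<one>\<^bsub>P\<^esub>"
    and incl: "\<And>w g. w \<in> U \<Longrightarrow> g \<in> carrier (G w) \<Longrightarrow> Q (incl w g)"
    and mult: "\<And>p q. p \<in> parabolic U \<Longrightarrow> q \<in> parabolic U \<Longrightarrow> Q p \<Longrightarrow> Q q \<Longrightarrow> Q (p \<otimes>\<^bsub>P\<^esub> q)"
  shows "Q p"
  using assms(2) unfolding parabolic_def
proof (induction rule: generate.induct)
  case (inv h)
  then obtain w g where "w \<in> U" "g \<in> carrier (G w)" "h = incl w g"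
    by (auto simp: vertex_group_eq)
  moreover from this have "w \<in> verts \<Gamma>" using assms(1) by blast
  ultimately show ?case
    using incl[of w "inv\<^bsub>G w\<^esub> g"] group.inv_closed[OF is_group] by (simp add: incl_inv)
qed (auto simp: vertex_group_eq parabolic_def intro: one incl mult)

lemma parabolic_cancel_right:
  assumes "U \<subseteq> verts \<Gamma>" "p \<in> carrier P" "q \<in> parabolic U"
  shows "p \<otimes>\<^bsub>P\<^esub> q \<in> parabolic U \<longleftrightarrow> p \<in> parabolic U"
proof -
  interpret subgroup "parabolic U" P using assms by (intro subgroup_parabolic)
  have "p \<otimes>\<^bsub>P\<^esub> q \<otimes>\<^bsub>P\<^esub> inv\<^bsub>P\<^esub> q = p"
    using assms by (simp add: P.m_assoc)
  then show ?thesis using assms m_closed m_inv_closed by metis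
qed

lemma parabolic_cancel_left:
  assumes "U \<subseteq> verts \<Gamma>" "p \<in> carrier P" "q \<in> parabolic U"
  shows "q \<otimes>\<^bsub>P\<^esub> p \<in> parabolic U \<longleftrightarrow> p \<in> parabolic U"
proof -
  interpret subgroup "parabolic U" P using assms by (intro subgroup_parabolic)
  have "inv\<^bsub>P\<^esub> q \<otimes>\<^bsub>P\<^esub> (q \<otimes>\<^bsub>P\<^esub> p) = p"
    using assms by (simp flip: P.m_assoc)
  then show ?thesis using assms m_closed m_inv_closed by metis
qed

section \<open>Gate maps\<close>

text \<open>
  The rule by which the projection to the clique \<open>G v\<close> changes along an edge of the Cayley graph: it
  follows the edges that are parallel to the clique and is constant along all others.
\<close>

definition is_gate_map :: "'v \<Rightarrow> (('v \<times> 'g) list set set \<Rightarrow> 'g) \<Rightarrow> bool" where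
  "is_gate_map v \<pi> \<longleftrightarrow> \<pi> \<one>\<^bsub>P\<^esub> = \<one>\<^bsub>G v\<^esub> \<and>
     (\<forall>p\<in>carrier P. \<pi> p \<in> carrier (G v) \<and>
        (\<forall>w\<in>verts \<Gamma>. \<forall>t\<in>carrier (G w). \<pi> (p \<otimes>\<^bsub>P\<^esub> incl w t) =
           (if w = v \<and> p \<in> parabolic (star v) then \<pi> p \<otimes>\<^bsub>G v\<^esub> t else \<pi> p)))"

text \<open>
  The action behind the gate map. In the cases of \<open>act\<close> below, the only delicate relations are those
  involving \<open>G v\<close>, and there the second component stays inside or outside of the subgroup of the
  star (fact \<open>S\<close>), so that both sides take the same branch.
\<close>

lemma gate_map_exists:
  assumes v: "v \<in> verts \<Gamma>"
  shows "\<exists>\<pi>. is_gate_map v \<pi>"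
proof -
  interpret Gv: group "G v" using is_group v by blast
  let ?S = "parabolic (star v)"
  define M where "M = carrier (G v) \<times> carrier P"
  define act where "act = (\<lambda>(a, p) (w, t).
    (if w = v \<and> p \<in> ?S then a \<otimes>\<^bsub>G v\<^esub> t else a, p \<otimes>\<^bsub>P\<^esub> incl w t))"
  have S: "p \<otimes>\<^bsub>P\<^esub> incl w t \<in> ?S \<longleftrightarrow> p \<in> ?S"
    if "p \<in> carrier P" "w \<in> star v" "t \<in> carrier (G w)" for p w t
    using that v by (intro parabolic_cancel_right incl_in_parabolic) auto
  obtain E where E_one: "\<And>x. x \<in> M \<Longrightarrow> E x \<one>\<^bsub>P\<^esub> = x"
    and E_closed: "\<And>x p. x \<in> M \<Longrightarrow> p \<in> carrier P \<Longrightarrow> E x p \<in> M"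
    and E_mult: "\<And>x p w t. x \<in> M \<Longrightarrow> p \<in> carrier P \<Longrightarrow> w \<in> verts \<Gamma> \<Longrightarrow> t \<in> carrier (G w) \<Longrightarrow>
          E x (p \<otimes>\<^bsub>P\<^esub> incl w t) = act (E x p) (w, t)"
  proof (rule right_action_extends[of M act])
    show "act x (w, t) \<in> M" if "x \<in> M" "w \<in> verts \<Gamma>" "t \<in> carrier (G w)" for x w t
      using that by (auto simp: M_def act_def)
    show "act x (w, \<one>\<^bsub>G w\<^esub>) = x" if "x \<in> M" "w \<in> verts \<Gamma>" for x w
      using that by (auto simp: M_def act_def)
    show "act (act x (w, s)) (w, t) = act x (w, s \<otimes>\<^bsub>G w\<^esub> t)"
      if "x \<in> M" "w \<in> verts \<Gamma>" "s \<in> carrier (G w)" "t \<in> carrier (G w)" for x w s t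
      using that by (auto simp: M_def act_def S P.m_assoc Gv.m_assoc incl_mult)
    show "act (act x (w, s)) (u, t) = act (act x (u, t)) (w, s)"
      if "x \<in> M" and wu: "{w, u} \<in> edges \<Gamma>" and "s \<in> carrier (G w)" "t \<in> carrier (G u)"
      for x w u s t
    proof -
      have "w \<noteq> u" "w \<in> verts \<Gamma>" "u \<in> verts \<Gamma>" using edge_verts[OF wu] by auto
      moreover have "w = v \<Longrightarrow> u \<in> star v" "u = v \<Longrightarrow> w \<in> star v"
        using wu by (auto simp: star_def insert_commute)
      ultimately show ?thesis
        using that incl_commute[OF wu] by (auto simp: M_def act_def S P.m_assoc)
    qed
  qed blast
  let ?x = "(\<one>\<^bsub>G v\<^esub>, \<one>\<^bsub>P\<^esub>)"
  have x: "?x \<in> M" by (simp add: M_def)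
  \<comment> \<open>The second component records the position in the Cayley graph, so the branch that \<open>act\<close>
    takes at \<open>p\<close> depends on \<open>p\<close> only.\<close>
  have snd_E: "snd (E ?x p) = p" if "p \<in> carrier P" for p
    using that
  proof (induction rule: graph_product_induct)
    case one
    then show ?case by (simp add: E_one x)
  next
    case (mult p w t)
    then show ?case by (auto simp: E_mult x act_def split: prod.split)
  qed
  have "is_gate_map v (\<lambda>p. fst (E ?x p))"
    unfolding is_gate_map_def
  proof (intro conjI ballI)
    show "fst (E ?x \<one>\<^bsub>P\<^esub>) = \<one>\<^bsub>G v\<^esub>" by (simp add: E_one x)
    show "fst (E ?x p) \<in> carrier (G v)" if "p \<in> carrier P" for p
      using E_closed[OF x that] by (auto simp: M_def)
    show "fst (E ?x (p \<otimes>\<^bsub>P\<^esub> incl w t)) =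
        (if w = v \<and> p \<in> ?S then fst (E ?x p) \<otimes>\<^bsub>G v\<^esub> t else fst (E ?x p))"
      if "p \<in> carrier P" "w \<in> verts \<Gamma>" "t \<in> carrier (G w)" for p w t
      using that snd_E[OF that(1)] by (cases "E ?x p") (simp add: E_mult x act_def)
  qed
  then show ?thesis by blast
qed

definition gate :: "'v \<Rightarrow> ('v \<times> 'g) list set set \<Rightarrow> 'g" where
  "gate v = (SOME \<pi>. is_gate_map v \<pi>)"

context
  fixes v
  assumes v: "v \<in> verts \<Gamma>"
begin

interpretation Gv: group "G v" using is_group v .

lemma is_gate_map_gate: "is_gate_map v (gate v)"
  unfolding gate_def using gate_map_exists[OF v] by (rule someI_ex)

lemma gate_one: "gate v \<one>\<^bsub>P\<^esub> = \<one>\<^bsub>G v\<^esub>"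
  using is_gate_map_gate by (simp add: is_gate_map_def)

lemma gate_closed: "p \<in> carrier P \<Longrightarrow> gate v p \<in> carrier (G v)"
  using is_gate_map_gate by (simp add: is_gate_map_def)

lemma gate_mult:
  "p \<in> carrier P \<Longrightarrow> w \<in> verts \<Gamma> \<Longrightarrow> t \<in> carrier (G w) \<Longrightarrow> gate v (p \<otimes>\<^bsub>P\<^esub> incl w t) =
     (if w = v \<and> p \<in> parabolic (star v) then gate v p \<otimes>\<^bsub>G v\<^esub> t else gate v p)"
  using is_gate_map_gate by (simp add: is_gate_map_def)

lemma gate_equivariant:
  assumes "p \<in> carrier P" and g: "g \<in> carrier (G v)"
  shows "gate v (incl v g \<otimes>\<^bsub>P\<^esub> p) = g \<otimes>\<^bsub>G v\<^esub> gate v p"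
  using assms(1)
proof (induction rule: graph_product_induct)
  case one
  then show ?case using gate_mult[of "\<one>\<^bsub>P\<^esub>" v g] v g by (simp add: gate_one)
next
  case (mult p w t)
  have "incl v g \<otimes>\<^bsub>P\<^esub> p \<in> parabolic (star v) \<longleftrightarrow> p \<in> parabolic (star v)"
    using v g mult by (intro parabolic_cancel_left incl_in_parabolic) auto
  then show ?case
    using v g mult gate_mult[of "incl v g \<otimes>\<^bsub>P\<^esub> p" w t] gate_mult[of p w t]
    by (cases "w = v") (simp_all add: P.m_assoc Gv.m_assoc gate_closed)
qed

lemma gate_incl: "g \<in> carrier (G v) \<Longrightarrow> gate v (incl v g) = g"
  using gate_equivariant[of "\<one>\<^bsub>P\<^esub>" g] v by (simp add: gate_one)

text \<open>
  Along a path labelled by vertex groups of \<open>U\<close>, only an edge starting in the subgroup of the star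
  can change the gate.
\<close>

lemma gate_const_on_parabolic:
  assumes U: "U \<subseteq> verts \<Gamma>" and "h \<in> parabolic U" and "x \<in> carrier P"
    and "v \<in> U \<Longrightarrow> (\<And>k. k \<in> parabolic U \<Longrightarrow> x \<otimes>\<^bsub>P\<^esub> k \<notin> parabolic (star v))"
  shows "gate v (x \<otimes>\<^bsub>P\<^esub> h) = gate v x"
  using U assms(2-)
proof (induction arbitrary: x rule: parabolic_induct)
  case one
  then show ?case by simp
next
  case (incl w g)
  then have "w \<in> verts \<Gamma>" "w = v \<Longrightarrow> x \<notin> parabolic (star v)"
    using U incl.prems(2)[of "\<one>\<^bsub>P\<^esub>"] by auto
  then show ?case using incl by (auto simp: gate_mult)
next
  case (mult h k)
  interpret subgroup "parabolic U" P using U by (rule subgroup_parabolic)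
  have "gate v (x \<otimes>\<^bsub>P\<^esub> h \<otimes>\<^bsub>P\<^esub> k) = gate v (x \<otimes>\<^bsub>P\<^esub> h)"
    using mult by (intro mult.IH(2)) (auto simp: P.m_assoc)
  moreover have "gate v (x \<otimes>\<^bsub>P\<^esub> h) = gate v x"
    using mult by blast
  ultimately show ?case using mult by (simp add: P.m_assoc)
qed

lemma incl_in_parabolicD:
  assumes "U \<subseteq> verts \<Gamma>" "g \<in> carrier (G v)" "g \<noteq> \<one>\<^bsub>G v\<^esub>" "incl v g \<in> parabolic U"
  shows "v \<in> U"
  using gate_const_on_parabolic[of U "incl v g" "\<one>\<^bsub>P\<^esub>"] assms v
  by (auto simp: gate_incl gate_one)

lemma incl_eq_inclD:
  assumes "g \<in> carrier (G v)" "g \<noteq> \<one>\<^bsub>G v\<^esub>" "w \<in> verts \<Gamma>" "h \<in> carrier (G w)" "incl v g = incl w h"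
  shows "v = w \<and> g = h"
proof -
  have "v \<in> {w}"
    using assms incl_in_parabolic[of w "{w}" h] by (intro incl_in_parabolicD[of _ g]) auto
  then show ?thesis using assms gate_incl[of g] gate_incl[of h] by simp
qed

text \<open>
  Left multiplication by \<open>g\<close> moves the gate of \<open>p\<close>, so the edge from \<open>p\<close> labelled \<open>h\<close> must move it
  too. For \<open>h\<close> in the same vertex group, this computes the normalizer of a vertex group.
\<close>

lemma intertwined_in_star:
  assumes "g \<in> carrier (G v)" "g \<noteq> \<one>\<^bsub>G v\<^esub>" "w \<in> verts \<Gamma>" "h \<in> carrier (G w)" "p \<in> carrier P"
    and "incl v g \<otimes>\<^bsub>P\<^esub> p = p \<otimes>\<^bsub>P\<^esub> incl w h"
  shows "v = w \<and> p \<in> parabolic (star v)"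
proof (rule ccontr)
  assume "\<not> ?thesis"
  then have "gate v (p \<otimes>\<^bsub>P\<^esub> incl w h) = gate v p" using assms by (auto simp: gate_mult)
  then have "g \<otimes>\<^bsub>G v\<^esub> gate v p = gate v p" using assms by (simp flip: gate_equivariant)
  then show False using assms gate_closed[of p] Gv.r_cancel_one by simp
qed

text \<open>
  The gates of \<open>inv q\<close> and of \<open>inv q \<otimes> h = incl v g \<otimes> inv q\<close> differ by \<open>g\<close>, so the gate changes
  somewhere on a path labelled by \<open>h\<close> and starting at \<open>inv q\<close>; the vertex \<open>inv q \<otimes> k\<close> where it
  changes lies in the subgroup of the star.
\<close>

lemma conjugate_in_parabolic:
  assumes U: "U \<subseteq> verts \<Gamma>" and g: "g \<in> carrier (G v)" "g \<noteq> \<one>\<^bsub>G v\<^esub>"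
    and q: "q \<in> carrier P" and h: "h \<in> parabolic U" "h \<otimes>\<^bsub>P\<^esub> q = q \<otimes>\<^bsub>P\<^esub> incl v g"
  shows "v \<in> U \<and> (\<exists>k\<in>parabolic U. inv\<^bsub>P\<^esub> q \<otimes>\<^bsub>P\<^esub> k \<in> parabolic (star v))"
proof (rule ccontr)
  assume neg: "\<not> ?thesis"
  have hc: "h \<in> carrier P" using U h parabolic_closed by blast
  have i: "incl v g \<in> carrier P" using g v by simp
  have "q \<otimes>\<^bsub>P\<^esub> (incl v g \<otimes>\<^bsub>P\<^esub> inv\<^bsub>P\<^esub> q) = h \<otimes>\<^bsub>P\<^esub> q \<otimes>\<^bsub>P\<^esub> inv\<^bsub>P\<^esub> q"
    using q i by (simp add: h(2) P.m_assoc)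
  then have "inv\<^bsub>P\<^esub> q \<otimes>\<^bsub>P\<^esub> h = incl v g \<otimes>\<^bsub>P\<^esub> inv\<^bsub>P\<^esub> q"
    using q i hc by (simp add: P.m_assoc P.inv_solve_left')
  then have "gate v (inv\<^bsub>P\<^esub> q \<otimes>\<^bsub>P\<^esub> h) = g \<otimes>\<^bsub>G v\<^esub> gate v (inv\<^bsub>P\<^esub> q)"
    using g q by (simp add: gate_equivariant)
  moreover have "gate v (inv\<^bsub>P\<^esub> q \<otimes>\<^bsub>P\<^esub> h) = gate v (inv\<^bsub>P\<^esub> q)"
    using U h q neg by (intro gate_const_on_parabolic) auto
  ultimately show False using g q gate_closed[of "inv\<^bsub>P\<^esub> q"] Gv.r_cancel_one by simp
qed

end

end

section \<open>Conjugates of vertex groups\<close>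

lemma (in group) inv_cancel_left:
  "p \<in> carrier G \<Longrightarrow> q \<in> carrier G \<Longrightarrow> inv p \<otimes> (p \<otimes> q) = q"
  "p \<in> carrier G \<Longrightarrow> q \<in> carrier G \<Longrightarrow> p \<otimes> (inv p \<otimes> q) = q"
  by (simp_all flip: m_assoc)

locale nontrivial_graph_of_groups = graph_of_groups \<Gamma> G
  for \<Gamma> :: "'v sgraph" and G :: "'v \<Rightarrow> ('g, 'b) monoid_scheme" +
  assumes nontrivial: "\<And>v. v \<in> verts \<Gamma> \<Longrightarrow> carrier (G v) \<noteq> {\<one>\<^bsub>G v\<^esub>}"
begin

lemma nontrivial_element:
  assumes "v \<in> verts \<Gamma>"
  obtains g where "g \<in> carrier (G v)" "g \<noteq> \<one>\<^bsub>G v\<^esub>"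
  using nontrivial[OF assms] is_group[OF assms] by (metis group.is_monoid insert_absorb
      is_singletonI' is_singleton_def monoid.one_closed singleton_iff empty_iff)

abbreviation conj_vg :: "('v \<times> 'g) list set set \<Rightarrow> 'v \<Rightarrow> ('v \<times> 'g) list set set set" where
  "conj_vg p v \<equiv> conjugate P p (vertex_group \<Gamma> G v)"

lemma conj_vg_eq:
  assumes "p \<in> carrier P" "v \<in> verts \<Gamma>"
  shows "conj_vg p v = {p \<otimes>\<^bsub>P\<^esub> incl v g \<otimes>\<^bsub>P\<^esub> inv\<^bsub>P\<^esub> p | g. g \<in> carrier (G v)}"
  using assms by (simp add: P.conjugate_eq vertex_group_closed) (auto simp: vertex_group_eq)

lemma conj_vg_mult:
  "p \<in> carrier P \<Longrightarrow> q \<in> carrier P \<Longrightarrow> v \<in> verts \<Gamma> \<Longrightarrow>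
     conjugate P p (conj_vg q v) = conj_vg (p \<otimes>\<^bsub>P\<^esub> q) v"
  by (rule P.conjugate_mult[OF _ _ vertex_group_closed])

text \<open>
  The vertex group normalizes itself, and the adjacent vertex groups centralize it.
\<close>

lemma star_normalizes:
  assumes v: "v \<in> verts \<Gamma>" and "p \<in> parabolic (star v)"
  shows "conj_vg p v = vertex_group \<Gamma> G v"
  using star_subset[OF v] assms(2)
proof (induction rule: parabolic_induct)
  case one
  show ?case using v by (simp add: P.conjugate_one vertex_group_closed)
next
  case (incl w t)
  interpret Gv: group "G v" using is_group v .
  have w: "w \<in> verts \<Gamma>" using incl star_subset[OF v] by blast
  show ?case
  proof (cases "w = v")
    case True
    have t: "t \<in> carrier (G v)" using incl True by simp
    have "conj_vg (incl v t) v = (\<lambda>g. incl v (t \<otimes>\<^bsub>G v\<^esub> g \<otimes>\<^bsub>G v\<^esub> inv\<^bsub>G v\<^esub> t)) ` carrier (G v)"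
      using t v by (simp add: conj_vg_eq Setcompr_eq_image incl_mult incl_inv cong: image_cong_simp)
    also have "\<dots> = incl v ` (\<lambda>g. t \<otimes>\<^bsub>G v\<^esub> g \<otimes>\<^bsub>G v\<^esub> inv\<^bsub>G v\<^esub> t) ` carrier (G v)"
      by (simp add: image_image)
    also have "(\<lambda>g. t \<otimes>\<^bsub>G v\<^esub> g \<otimes>\<^bsub>G v\<^esub> inv\<^bsub>G v\<^esub> t) ` carrier (G v) = carrier (G v)"
    proof (intro equalityI subsetI)
      fix g assume "g \<in> carrier (G v)"
      then show "g \<in> (\<lambda>g. t \<otimes>\<^bsub>G v\<^esub> g \<otimes>\<^bsub>G v\<^esub> inv\<^bsub>G v\<^esub> t) ` carrier (G v)"
        using t by (intro image_eqI[of _ _ "inv\<^bsub>G v\<^esub> t \<otimes>\<^bsub>G v\<^esub> g \<otimes>\<^bsub>G v\<^esub> t"])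
          (simp_all add: Gv.m_assoc Gv.inv_cancel_left)
    qed (use t in auto)
    finally show ?thesis using True by (simp add: vertex_group_eq)
  next
    case False
    then have "{v, w} \<in> edges \<Gamma>" using incl by (auto simp: star_def)
    then have "incl w t \<otimes>\<^bsub>P\<^esub> incl v g \<otimes>\<^bsub>P\<^esub> inv\<^bsub>P\<^esub> incl w t = incl v g" if "g \<in> carrier (G v)" for g
      using that incl v w by (simp add: P.m_assoc flip: incl_commute)
    then show ?thesis
      using incl v w by (simp add: conj_vg_eq Setcompr_eq_image cong: image_cong_simp)
        (simp add: vertex_group_eq)
  qed
next
  case (mult p q)
  then show ?case
    using v conj_vg_mult[of p q v] parabolic_closed[OF star_subset[OF v]] by simp
qed

lemma conj_vg_eq_iff:
  assumes "p \<in> carrier P" "v \<in> verts \<Gamma>" "q \<in> carrier P" "w \<in> verts \<Gamma>"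
  shows "conj_vg p v = conj_vg q w \<longleftrightarrow> v = w \<and> inv\<^bsub>P\<^esub> p \<otimes>\<^bsub>P\<^esub> q \<in> parabolic (star v)"
proof
  assume eq: "conj_vg p v = conj_vg q w"
  obtain g where g: "g \<in> carrier (G v)" "g \<noteq> \<one>\<^bsub>G v\<^esub>" using nontrivial_element assms by blast
  then have "p \<otimes>\<^bsub>P\<^esub> incl v g \<otimes>\<^bsub>P\<^esub> inv\<^bsub>P\<^esub> p \<in> conj_vg q w"
    using assms by (auto simp: conj_vg_eq simp flip: eq)
  then obtain h where h: "h \<in> carrier (G w)"
    and "p \<otimes>\<^bsub>P\<^esub> incl v g \<otimes>\<^bsub>P\<^esub> inv\<^bsub>P\<^esub> p = q \<otimes>\<^bsub>P\<^esub> incl w h \<otimes>\<^bsub>P\<^esub> inv\<^bsub>P\<^esub> q"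
    using assms by (auto simp: conj_vg_eq)
  then have "inv\<^bsub>P\<^esub> p \<otimes>\<^bsub>P\<^esub> (p \<otimes>\<^bsub>P\<^esub> incl v g \<otimes>\<^bsub>P\<^esub> inv\<^bsub>P\<^esub> p) \<otimes>\<^bsub>P\<^esub> q =
      inv\<^bsub>P\<^esub> p \<otimes>\<^bsub>P\<^esub> (q \<otimes>\<^bsub>P\<^esub> incl w h \<otimes>\<^bsub>P\<^esub> inv\<^bsub>P\<^esub> q) \<otimes>\<^bsub>P\<^esub> q"
    by simp
  moreover have "inv\<^bsub>P\<^esub> p \<otimes>\<^bsub>P\<^esub> (p \<otimes>\<^bsub>P\<^esub> incl v g \<otimes>\<^bsub>P\<^esub> inv\<^bsub>P\<^esub> p) \<otimes>\<^bsub>P\<^esub> q = incl v g \<otimes>\<^bsub>P\<^esub> (inv\<^bsub>P\<^esub> p \<otimes>\<^bsub>P\<^esub> q)"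
    using assms g by (simp add: P.m_assoc P.inv_cancel_left)
  moreover have "inv\<^bsub>P\<^esub> p \<otimes>\<^bsub>P\<^esub> (q \<otimes>\<^bsub>P\<^esub> incl w h \<otimes>\<^bsub>P\<^esub> inv\<^bsub>P\<^esub> q) \<otimes>\<^bsub>P\<^esub> q = inv\<^bsub>P\<^esub> p \<otimes>\<^bsub>P\<^esub> q \<otimes>\<^bsub>P\<^esub> incl w h"
    using assms h by (simp add: P.m_assoc)
  ultimately have "incl v g \<otimes>\<^bsub>P\<^esub> (inv\<^bsub>P\<^esub> p \<otimes>\<^bsub>P\<^esub> q) = inv\<^bsub>P\<^esub> p \<otimes>\<^bsub>P\<^esub> q \<otimes>\<^bsub>P\<^esub> incl w h"
    by simp
  then show "v = w \<and> inv\<^bsub>P\<^esub> p \<otimes>\<^bsub>P\<^esub> q \<in> parabolic (star v)"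
    using assms g h by (intro intertwined_in_star) auto
next
  assume r: "v = w \<and> inv\<^bsub>P\<^esub> p \<otimes>\<^bsub>P\<^esub> q \<in> parabolic (star v)"
  have "conj_vg q v = conj_vg (p \<otimes>\<^bsub>P\<^esub> (inv\<^bsub>P\<^esub> p \<otimes>\<^bsub>P\<^esub> q)) v"
    using assms by (simp add: P.inv_cancel_left)
  also have "\<dots> = conjugate P p (conj_vg (inv\<^bsub>P\<^esub> p \<otimes>\<^bsub>P\<^esub> q) v)"
    using assms by (simp add: conj_vg_mult)
  also have "\<dots> = conj_vg p v"
    using star_normalizes[OF assms(2) conjunct2[OF r]] by simp
  finally show "conj_vg p v = conj_vg q w" using r by simp
qed

text \<open>
  With \<open>x = inv p \<otimes> q\<close>, each \<open>t\<close> in the vertex group of \<open>w\<close> is conjugated by \<open>x\<close> into the normalizer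
  of the vertex group of \<open>v\<close>, which is the subgroup of its star. Then \<open>x\<close> is a product of an element
  \<open>k\<close> of that subgroup and one of the subgroup of the star of \<open>w\<close>, and \<open>p \<otimes> k\<close> serves as a common
  base point because the subgroup of a star normalizes its centre.
\<close>

lemma commuting_conjugates:
  assumes p: "p \<in> carrier P" and v: "v \<in> verts \<Gamma>" and q: "q \<in> carrier P" and w: "w \<in> verts \<Gamma>"
    and neq: "conj_vg p v \<noteq> conj_vg q w"
    and comm: "\<And>a b. a \<in> conj_vg p v \<Longrightarrow> b \<in> conj_vg q w \<Longrightarrow> a \<otimes>\<^bsub>P\<^esub> b = b \<otimes>\<^bsub>P\<^esub> a"
  obtains a where "a \<in> carrier P" "{v, w} \<in> edges \<Gamma>" "conj_vg p v = conj_vg a v"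
    "conj_vg q w = conj_vg a w"
proof -
  obtain s where s: "s \<in> carrier (G v)" "s \<noteq> \<one>\<^bsub>G v\<^esub>" using nontrivial_element v by blast
  obtain t where t: "t \<in> carrier (G w)" "t \<noteq> \<one>\<^bsub>G w\<^esub>" using nontrivial_element w by blast
  define x where "x = inv\<^bsub>P\<^esub> p \<otimes>\<^bsub>P\<^esub> q"
  define h where "h = x \<otimes>\<^bsub>P\<^esub> incl w t \<otimes>\<^bsub>P\<^esub> inv\<^bsub>P\<^esub> x"
  define s' where "s' = incl v s"
  define t' where "t' = incl w t"
  have cl: "x \<in> carrier P" "h \<in> carrier P" "s' \<in> carrier P" "t' \<in> carrier P"
    using p q s v t w by (auto simp: x_def h_def s'_def t'_def)
  have q_eq: "q = p \<otimes>\<^bsub>P\<^esub> x" using p q by (simp add: x_def P.inv_cancel_left)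
  have "(p \<otimes>\<^bsub>P\<^esub> s' \<otimes>\<^bsub>P\<^esub> inv\<^bsub>P\<^esub> p) \<otimes>\<^bsub>P\<^esub> (q \<otimes>\<^bsub>P\<^esub> t' \<otimes>\<^bsub>P\<^esub> inv\<^bsub>P\<^esub> q) =
      (q \<otimes>\<^bsub>P\<^esub> t' \<otimes>\<^bsub>P\<^esub> inv\<^bsub>P\<^esub> q) \<otimes>\<^bsub>P\<^esub> (p \<otimes>\<^bsub>P\<^esub> s' \<otimes>\<^bsub>P\<^esub> inv\<^bsub>P\<^esub> p)"
    using s t by (intro comm) (auto simp: conj_vg_eq p v q w s'_def t'_def)
  also have "q \<otimes>\<^bsub>P\<^esub> t' \<otimes>\<^bsub>P\<^esub> inv\<^bsub>P\<^esub> q = p \<otimes>\<^bsub>P\<^esub> h \<otimes>\<^bsub>P\<^esub> inv\<^bsub>P\<^esub> p"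
    using p cl by (simp add: q_eq h_def P.m_assoc P.inv_mult_group flip: t'_def)
  finally have "p \<otimes>\<^bsub>P\<^esub> (s' \<otimes>\<^bsub>P\<^esub> h) \<otimes>\<^bsub>P\<^esub> inv\<^bsub>P\<^esub> p = p \<otimes>\<^bsub>P\<^esub> (h \<otimes>\<^bsub>P\<^esub> s') \<otimes>\<^bsub>P\<^esub> inv\<^bsub>P\<^esub> p"
    using p cl by (simp add: P.m_assoc P.inv_cancel_left)
  then have "incl v s \<otimes>\<^bsub>P\<^esub> h = h \<otimes>\<^bsub>P\<^esub> incl v s"
    using p cl unfolding s'_def by simp
  then have "h \<in> parabolic (star v)"
    using intertwined_in_star[OF v s v s(1) cl(2)] by blast
  moreover have "h \<otimes>\<^bsub>P\<^esub> x = x \<otimes>\<^bsub>P\<^esub> incl w t"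
    using cl unfolding h_def t'_def by (simp add: P.m_assoc)
  ultimately obtain k where wk: "w \<in> star v" "k \<in> parabolic (star v)"
      "inv\<^bsub>P\<^esub> x \<otimes>\<^bsub>P\<^esub> k \<in> parabolic (star w)"
    using conjugate_in_parabolic[OF w star_subset[OF v] t cl(1)] by blast
  have k: "k \<in> carrier P" using parabolic_closed[OF star_subset[OF v] wk(2)] .
  have "inv\<^bsub>P\<^esub> p \<otimes>\<^bsub>P\<^esub> (p \<otimes>\<^bsub>P\<^esub> k) = k" using p k by (simp add: P.inv_cancel_left)
  then have 1: "conj_vg p v = conj_vg (p \<otimes>\<^bsub>P\<^esub> k) v"
    using p k v wk by (simp add: conj_vg_eq_iff)
  have "inv\<^bsub>P\<^esub> q \<otimes>\<^bsub>P\<^esub> (p \<otimes>\<^bsub>P\<^esub> k) = inv\<^bsub>P\<^esub> x \<otimes>\<^bsub>P\<^esub> k"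
    using p q k by (simp add: x_def P.inv_mult_group P.m_assoc)
  then have 2: "conj_vg q w = conj_vg (p \<otimes>\<^bsub>P\<^esub> k) w"
    using p q k w wk by (simp add: conj_vg_eq_iff)
  have "w \<noteq> v" using neq 1 2 by auto
  then have "{v, w} \<in> edges \<Gamma>" using wk(1) by (auto simp: star_def)
  then show thesis using that[of "p \<otimes>\<^bsub>P\<^esub> k"] p k 1 2 by simp
qed

end

section \<open>Triangles and squares\<close>

lemma simplicial_edge_neq: "simplicial_graph Y \<Longrightarrow> {x, y} \<in> edges Y \<Longrightarrow> x \<noteq> y"
  by (fastforce simp: simplicial_graph_def doubleton_eq_iff)

lemma simplicial_edge_verts: "simplicial_graph Y \<Longrightarrow> {x, y} \<in> edges Y \<Longrightarrow> x \<in> verts Y \<and> y \<in> verts Y"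
  by (fastforce simp: simplicial_graph_def doubleton_eq_iff)

lemma edges_circuit_3: "edges (circuit 3) = {{0, 1}, {1, 2}, {2, 0}}"
proof -
  have mod: "Suc 0 mod 3 = 1" "Suc 1 mod 3 = 2" "Suc 2 mod 3 = 0" by simp_all
  have "edges (circuit 3) = (\<lambda>i. {i, Suc i mod 3}) ` {..<3}"
    by (auto simp: circuit_def)
  also have "{..<3::nat} = {0, 1, 2}" by auto
  also have "(\<lambda>i. {i, Suc i mod 3}) ` {0, 1, 2} = {{0, Suc 0 mod 3}, {1, Suc 1 mod 3}, {2, Suc 2 mod 3}}"
    by (simp only: image_insert image_empty)
  also have "\<dots> = {{0, 1}, {1, 2}, {2, 0}}"
    by (simp only: mod)
  finally show ?thesis .
qed

lemma edges_circuit_4: "edges (circuit 4) = {{0, 1}, {1, 2}, {2, 3}, {3, 0}}"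
proof -
  have mod: "Suc 0 mod 4 = 1" "Suc 1 mod 4 = 2" "Suc 2 mod 4 = 3" "Suc 3 mod 4 = 0" by simp_all
  have "edges (circuit 4) = (\<lambda>i. {i, Suc i mod 4}) ` {..<4}"
    by (auto simp: circuit_def)
  also have "{..<4::nat} = {0, 1, 2, 3}" by auto
  also have "(\<lambda>i. {i, Suc i mod 4}) ` {0, 1, 2, 3} =
      {{0, Suc 0 mod 4}, {1, Suc 1 mod 4}, {2, Suc 2 mod 4}, {3, Suc 3 mod 4}}"
    by (simp only: image_insert image_empty)
  also have "\<dots> = {{0, 1}, {1, 2}, {2, 3}, {3, 0}}"
    by (simp only: mod)
  finally show ?thesis .
qed

text \<open>
  Since the parametrization maps onto \<open>U\<close>, adjacency in the induced subgraph is adjacency in \<open>Y\<close>.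
\<close>

lemma induced_circuit_iff:
  "induced_circuit n Y U \<longleftrightarrow> U \<subseteq> verts Y \<and>
     (\<exists>f. bij_betw f {..<n} U \<and>
        (\<forall>i<n. \<forall>j<n. {i, j} \<in> edges (circuit n) \<longleftrightarrow> {f i, f j} \<in> edges Y))"
proof -
  have "graph_isomorphism f (circuit n) (induced_subgraph Y U) \<longleftrightarrow> bij_betw f {..<n} U \<and>
        (\<forall>i<n. \<forall>j<n. {i, j} \<in> edges (circuit n) \<longleftrightarrow> {f i, f j} \<in> edges Y)" for f
    by (auto simp: graph_isomorphism_def induced_subgraph_def circuit_def dest: bij_betwE)
  then show ?thesis by (simp add: induced_circuit_def)
qed

lemma triangle_iff:
  assumes "simplicial_graph Y"
  shows "triangle Y T \<longleftrightarrow>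
    (\<exists>a b c. T = {a, b, c} \<and> {a, b} \<in> edges Y \<and> {b, c} \<in> edges Y \<and> {a, c} \<in> edges Y)"
proof
  assume "triangle Y T"
  then obtain f where f: "bij_betw f {..<3} T"
    "\<And>i j. i < 3 \<Longrightarrow> j < 3 \<Longrightarrow> {i, j} \<in> edges (circuit 3) \<longleftrightarrow> {f i, f j} \<in> edges Y"
    by (auto simp: induced_circuit_iff)
  have "T = f ` {..<3}" using f(1) by (simp add: bij_betw_def)
  also have "{..<3::nat} = {0, 1, 2}" by auto
  finally have "T = {f 0, f 1, f 2}" by simp
  moreover have "{f 0, f 1} \<in> edges Y" "{f 1, f 2} \<in> edges Y" "{f 0, f 2} \<in> edges Y"
    using f(2)[of 0 1] f(2)[of 1 2] f(2)[of 0 2] by (simp_all add: edges_circuit_3 doubleton_eq_iff)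
  ultimately show "\<exists>a b c. T = {a, b, c} \<and> {a, b} \<in> edges Y \<and> {b, c} \<in> edges Y \<and> {a, c} \<in> edges Y"
    by blast
next
  assume "\<exists>a b c. T = {a, b, c} \<and> {a, b} \<in> edges Y \<and> {b, c} \<in> edges Y \<and> {a, c} \<in> edges Y"
  then obtain a b c where T: "T = {a, b, c}"
    and e: "{a, b} \<in> edges Y" "{b, c} \<in> edges Y" "{a, c} \<in> edges Y"
    by blast
  note n = e[THEN simplicial_edge_neq[OF assms]]
  have l: "{x} \<notin> edges Y" for x using simplicial_edge_neq[OF assms, of x x] by auto
  define f where "f = (\<lambda>i::nat. if i = 0 then a else if i = 1 then b else c)"
  have 3: "{..<3::nat} = {0, 1, 2}" by auto
  have "bij_betw f {..<3} T"
    using n unfolding 3 T by (auto simp: bij_betw_def inj_on_def f_def)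
  moreover have "{i, j} \<in> edges (circuit 3) \<longleftrightarrow> {f i, f j} \<in> edges Y" if "i < 3" "j < 3" for i j
  proof -
    have "i \<in> {0, 1, 2}" "j \<in> {0, 1, 2}" using that by auto
    then show ?thesis
      using e l by (auto simp: f_def edges_circuit_3 doubleton_eq_iff insert_commute)
  qed
  moreover have "T \<subseteq> verts Y"
    using e[THEN simplicial_edge_verts[OF assms]] T by simp
  ultimately show "triangle Y T" by (auto simp: induced_circuit_iff)
qed

lemma square_iff:
  assumes "simplicial_graph Y"
  shows "square Y Q \<longleftrightarrow>
    (\<exists>a b c d. Q = {a, b, c, d} \<and> {a, b} \<in> edges Y \<and> {b, c} \<in> edges Y \<and> {c, d} \<in> edges Y \<and>
       {d, a} \<in> edges Y \<and> a \<noteq> c \<and> b \<noteq> d \<and> {a, c} \<notin> edges Y \<and> {b, d} \<notin> edges Y)"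
    (is "_ \<longleftrightarrow> ?R")
proof
  assume "square Y Q"
  then obtain f where f: "bij_betw f {..<4} Q"
    "\<And>i j. i < 4 \<Longrightarrow> j < 4 \<Longrightarrow> {i, j} \<in> edges (circuit 4) \<longleftrightarrow> {f i, f j} \<in> edges Y"
    by (auto simp: induced_circuit_iff)
  have inj: "inj_on f {..<4}" using f(1) by (simp add: bij_betw_def)
  have "Q = f ` {..<4}" using f(1) by (simp add: bij_betw_def)
  also have "{..<4::nat} = {0, 1, 2, 3}" by auto
  finally have "Q = {f 0, f 1, f 2, f 3}" by simp
  moreover have "f 0 \<noteq> f 2" "f 1 \<noteq> f 3"
    using inj_on_eq_iff[OF inj, of 0 2] inj_on_eq_iff[OF inj, of 1 3] by auto
  moreover have "{f 0, f 1} \<in> edges Y" "{f 1, f 2} \<in> edges Y" "{f 2, f 3} \<in> edges Y"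
      "{f 3, f 0} \<in> edges Y" "{f 0, f 2} \<notin> edges Y" "{f 1, f 3} \<notin> edges Y"
    using f(2)[of 0 1] f(2)[of 1 2] f(2)[of 2 3] f(2)[of 3 0] f(2)[of 0 2] f(2)[of 1 3]
    by (simp_all add: edges_circuit_4 doubleton_eq_iff)
  ultimately show ?R by blast
next
  assume ?R
  then obtain a b c d where Q: "Q = {a, b, c, d}"
    and e: "{a, b} \<in> edges Y" "{b, c} \<in> edges Y" "{c, d} \<in> edges Y" "{d, a} \<in> edges Y"
    and d: "a \<noteq> c" "b \<noteq> d" "{a, c} \<notin> edges Y" "{b, d} \<notin> edges Y"
    by blast
  note n = e[THEN simplicial_edge_neq[OF assms]]
  have l: "{x} \<notin> edges Y" for x using simplicial_edge_neq[OF assms, of x x] by auto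
  define f where "f = (\<lambda>i::nat. if i = 0 then a else if i = 1 then b else if i = 2 then c else d)"
  have 4: "{..<4::nat} = {0, 1, 2, 3}" by auto
  have "bij_betw f {..<4} Q"
    using n d unfolding 4 Q by (auto simp: bij_betw_def inj_on_def f_def)
  moreover have "{i, j} \<in> edges (circuit 4) \<longleftrightarrow> {f i, f j} \<in> edges Y" if "i < 4" "j < 4" for i j
  proof -
    have "i \<in> {0, 1, 2, 3}" "j \<in> {0, 1, 2, 3}" using that by auto
    then show ?thesis
      using e l d by (auto simp: f_def edges_circuit_4 doubleton_eq_iff insert_commute)
  qed
  moreover have "Q \<subseteq> verts Y"
    using e[THEN simplicial_edge_verts[OF assms]] Q by simp
  ultimately show "square Y Q" by (auto simp: induced_circuit_iff)
qed

lemma sides_square: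
  assumes "simplicial_graph Y" "{a, c} \<notin> edges Y" "{b, d} \<notin> edges Y" "e \<in> sides Y {a, b, c, d}"
  shows "e = {a, b} \<or> e = {b, c} \<or> e = {c, d} \<or> e = {d, a}"
proof -
  obtain x y where e: "e = {x, y}" "x \<noteq> y" "{x, y} \<in> edges Y" "x \<in> {a, b, c, d}" "y \<in> {a, b, c, d}"
    using assms(1,4) by (auto simp: induced_subgraph_def simplicial_graph_def)
  then show ?thesis using assms(2,3) by (auto simp: insert_commute)
qed

lemma doubleton_in_symmetric_family:
  assumes "\<And>x y. R x y \<Longrightarrow> R y x"
  shows "{x, y} \<in> {{x, y} | x y. R x y} \<longleftrightarrow> R x y"
  using assms by (auto simp: doubleton_eq_iff)

lemma crossing_graph_edge_iff:
  "{J, K} \<in> edges (crossing_graph Y) \<longleftrightarrow> J \<in> hyperplanes Y \<and> K \<in> hyperplanes Y \<and> J \<noteq> K \<and>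
     (\<exists>Q. square Y Q \<and> sides Y Q \<inter> J \<noteq> {} \<and> sides Y Q \<inter> K \<noteq> {})"
  unfolding crossing_graph_def sgraph.simps by (rule doubleton_in_symmetric_family) blast

lemma contact_graph_edge_iff:
  "{J, K} \<in> edges (contact_graph Y) \<longleftrightarrow> J \<in> hyperplanes Y \<and> K \<in> hyperplanes Y \<and> J \<noteq> K \<and>
     hyperplane_endpoints J \<inter> hyperplane_endpoints K \<noteq> {}"
  unfolding contact_graph_def sgraph.simps by (rule doubleton_in_symmetric_family) blast

section \<open>Edges of the Cayley graph\<close>

context nontrivial_graph_of_groups
begin

abbreviation X where "X \<equiv> cayley_graph P (graph_product_generators \<Gamma> G)"

text \<open>
  An oriented edge of the Cayley graph, together with the vertex whose group contains the generator
  that it carries.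
\<close>

definition step :: "'v \<Rightarrow> ('v \<times> 'g) list set set \<Rightarrow> ('v \<times> 'g) list set set \<Rightarrow> bool" where
  "step v p q \<longleftrightarrow> v \<in> verts \<Gamma> \<and> p \<in> carrier P \<and>
     (\<exists>g\<in>carrier (G v). g \<noteq> \<one>\<^bsub>G v\<^esub> \<and> q = p \<otimes>\<^bsub>P\<^esub> incl v g)"

lemma stepI:
  "v \<in> verts \<Gamma> \<Longrightarrow> p \<in> carrier P \<Longrightarrow> g \<in> carrier (G v) \<Longrightarrow> g \<noteq> \<one>\<^bsub>G v\<^esub> \<Longrightarrow> step v p (p \<otimes>\<^bsub>P\<^esub> incl v g)"
  by (auto simp: step_def)

lemma stepE:
  assumes "step v p q"
  obtains g where "v \<in> verts \<Gamma>" "p \<in> carrier P" "q \<in> carrier P" "g \<in> carrier (G v)"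
    "g \<noteq> \<one>\<^bsub>G v\<^esub>" "q = p \<otimes>\<^bsub>P\<^esub> incl v g"
  using assms by (auto simp: step_def)

lemma incl_eq_one_iff:
  "v \<in> verts \<Gamma> \<Longrightarrow> g \<in> carrier (G v) \<Longrightarrow> incl v g = \<one>\<^bsub>P\<^esub> \<longleftrightarrow> g = \<one>\<^bsub>G v\<^esub>"
  using gate_incl[of v g] gate_one[of v] by auto

lemma step_exists:
  assumes "v \<in> verts \<Gamma>" "p \<in> carrier P"
  obtains q where "step v p q"
proof -
  obtain g where "g \<in> carrier (G v)" "g \<noteq> \<one>\<^bsub>G v\<^esub>" using nontrivial_element[OF assms(1)] .
  then show thesis using that[OF stepI[OF assms]] by simp
qed

lemma step_neq: "step v p q \<Longrightarrow> p \<noteq> q"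
  by (erule stepE) (simp add: incl_eq_one_iff)

lemma step_sym:
  assumes "step v p q" shows "step v q p"
proof -
  obtain g where g: "v \<in> verts \<Gamma>" "p \<in> carrier P" "q \<in> carrier P" "g \<in> carrier (G v)"
    "g \<noteq> \<one>\<^bsub>G v\<^esub>" "q = p \<otimes>\<^bsub>P\<^esub> incl v g"
    using assms by (rule stepE)
  interpret Gv: group "G v" using is_group g(1) .
  have "p = q \<otimes>\<^bsub>P\<^esub> incl v (inv\<^bsub>G v\<^esub> g)"
    using g by (simp add: P.m_assoc incl_mult)
  then show ?thesis
    using g stepI[of v q "inv\<^bsub>G v\<^esub> g"] by simp
qed

lemma step_trans:
  assumes "step v p q" "step v q r" "p \<noteq> r" shows "step v p r"
proof -
  obtain g h where g: "v \<in> verts \<Gamma>" "p \<in> carrier P" "g \<in> carrier (G v)" "q = p \<otimes>\<^bsub>P\<^esub> incl v g"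
    and h: "h \<in> carrier (G v)" "r = q \<otimes>\<^bsub>P\<^esub> incl v h"
    using assms by (auto elim!: stepE)
  interpret Gv: group "G v" using is_group g(1) .
  have "r = p \<otimes>\<^bsub>P\<^esub> incl v (g \<otimes>\<^bsub>G v\<^esub> h)"
    using g h by (simp add: P.m_assoc incl_mult)
  then show ?thesis
    using g h stepI[of v p "g \<otimes>\<^bsub>G v\<^esub> h"] assms(3) by (cases "g \<otimes>\<^bsub>G v\<^esub> h = \<one>\<^bsub>G v\<^esub>") auto
qed

lemma step_unique:
  assumes "step v p q" "step w p q" shows "v = w"
proof -
  obtain g where g: "v \<in> verts \<Gamma>" "p \<in> carrier P" "g \<in> carrier (G v)" "g \<noteq> \<one>\<^bsub>G v\<^esub>"
      "q = p \<otimes>\<^bsub>P\<^esub> incl v g"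
    using assms(1) by (rule stepE)
  obtain h where h: "w \<in> verts \<Gamma>" "h \<in> carrier (G w)" "q = p \<otimes>\<^bsub>P\<^esub> incl w h"
    using assms(2) by (rule stepE)
  have "incl v g = incl w h" using g h by simp
  then show ?thesis using incl_eq_inclD[OF g(1,3,4) h(1,2)] by simp
qed

lemma step_translate: "r \<in> carrier P \<Longrightarrow> step v p q \<Longrightarrow> step v (r \<otimes>\<^bsub>P\<^esub> p) (r \<otimes>\<^bsub>P\<^esub> q)"
  by (elim stepE) (simp add: stepI flip: P.m_assoc)

lemma conj_vg_step:
  assumes "step w p q" "v \<in> verts \<Gamma>" "w \<in> star v"
  shows "conj_vg p v = conj_vg q v"
proof -
  obtain g where "p \<in> carrier P" "q \<in> carrier P" "w \<in> verts \<Gamma>" "g \<in> carrier (G w)" "q = p \<otimes>\<^bsub>P\<^esub> incl w g"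
    using assms(1) by (rule stepE)
  then show ?thesis
    using assms by (simp add: conj_vg_eq_iff P.inv_cancel_left incl_in_parabolic)
qed

lemma edges_cayley: "e \<in> edges X \<longleftrightarrow> (\<exists>v p q. step v p q \<and> e = {p, q})"
proof -
  have "s \<in> graph_product_generators \<Gamma> G \<longleftrightarrow>
      (\<exists>v\<in>verts \<Gamma>. \<exists>g\<in>carrier (G v). g \<noteq> \<one>\<^bsub>G v\<^esub> \<and> s = incl v g)" for s
  proof -
    have "s \<in> vertex_group \<Gamma> G v - {\<one>\<^bsub>P\<^esub>} \<longleftrightarrow> (\<exists>g\<in>carrier (G v). g \<noteq> \<one>\<^bsub>G v\<^esub> \<and> s = incl v g)"
      if "v \<in> verts \<Gamma>" for v
      using incl_eq_one_iff[OF that] unfolding vertex_group_eq Diff_iff image_iff singleton_iff by metis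
    then show ?thesis
      unfolding graph_product_generators_def UN_iff by (rule bex_cong[OF HOL.refl])
  qed
  then show ?thesis
    unfolding cayley_graph_def step_def by auto
qed

lemma edge_iff_step: "{p, q} \<in> edges X \<longleftrightarrow> (\<exists>v. step v p q)"
  by (auto simp: edges_cayley doubleton_eq_iff intro: step_sym)

lemma simplicial_cayley: "simplicial_graph X"
  unfolding simplicial_graph_def
proof (rule ballI)
  fix e assume "e \<in> edges X"
  then obtain v p q where s: "step v p q" "e = {p, q}" by (auto simp: edges_cayley)
  have "p \<in> verts X" "q \<in> verts X"
    using s(1) by (auto simp: cayley_graph_def elim: stepE)
  then show "\<exists>p\<in>verts X. \<exists>q\<in>verts X. p \<noteq> q \<and> e = {p, q}"
    using step_neq[OF s(1)] s(2) by (intro bexI conjI)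
qed

lemma gate_step:
  assumes v: "v \<in> verts \<Gamma>" and a: "a \<in> carrier P" and pq: "step w p q" and "w \<noteq> v"
  shows "gate v (a \<otimes>\<^bsub>P\<^esub> q) = gate v (a \<otimes>\<^bsub>P\<^esub> p)"
  using pq a v \<open>w \<noteq> v\<close> by (auto elim!: stepE simp: gate_mult simp flip: P.m_assoc)

text \<open>
  The gate of \<open>u\<close>, based at \<open>a\<close>, moves from \<open>a\<close> to \<open>b\<close>. If the second side came from another vertex
  group, the third side would have to make the same move and so end at \<open>b\<close>.
\<close>

lemma triangle_step:
  assumes ab: "step u a b" and bc: "step v b c" and ac: "step w a c"
  shows "u = v \<and> w = u"
proof -
  obtain g where g: "u \<in> verts \<Gamma>" "a \<in> carrier P" "g \<in> carrier (G u)" "g \<noteq> \<one>\<^bsub>G u\<^esub>" "b = a \<otimes>\<^bsub>P\<^esub> incl u g"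
    using ab by (rule stepE)
  obtain h where h: "w \<in> verts \<Gamma>" "h \<in> carrier (G w)" "c = a \<otimes>\<^bsub>P\<^esub> incl w h"
    using ac by (rule stepE)
  have b: "gate u (inv\<^bsub>P\<^esub> a \<otimes>\<^bsub>P\<^esub> b) = g"
    using g by (simp add: P.inv_cancel_left gate_incl)
  have "u = v"
  proof (rule ccontr)
    assume "u \<noteq> v"
    then have c: "gate u (inv\<^bsub>P\<^esub> a \<otimes>\<^bsub>P\<^esub> c) = g"
      using gate_step[OF g(1) _ bc, of "inv\<^bsub>P\<^esub> a"] g(2) b by simp
    have "w = u"
    proof (rule ccontr)
      assume "w \<noteq> u"
      then have "gate u (inv\<^bsub>P\<^esub> a \<otimes>\<^bsub>P\<^esub> c) = \<one>\<^bsub>G u\<^esub>"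
        using gate_step[OF g(1) _ ac, of "inv\<^bsub>P\<^esub> a"] g(1,2) by (simp add: gate_one)
      then show False using c g(4) by simp
    qed
    then have "b = c" using c g h by (simp add: P.inv_cancel_left gate_incl)
    then show False using step_neq[OF bc] by simp
  qed
  moreover have "w = u"
    using step_unique[OF step_trans[OF ab _ step_neq[OF ac]] ac] bc \<open>u = v\<close> by simp
  ultimately show ?thesis by simp
qed

text \<open>
  Around the closed path the gate of \<open>u\<close>, based at \<open>a\<close>, has to return to its initial value. Only the
  third side can undo the change made on the first one; so it comes from \<open>u\<close>, and it starts in the
  subgroup of the star of \<open>u\<close>, which forces \<open>v\<close> to be adjacent to \<open>u\<close>.
\<close>

lemma square_step:
  assumes ab: "step u a b" and bc: "step v b c" and cd: "step w c d" and da: "step z d a"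
    and uv: "u \<noteq> v" and zu: "z \<noteq> u"
  shows "w = u \<and> {u, v} \<in> edges \<Gamma>"
proof -
  obtain g where g: "u \<in> verts \<Gamma>" "a \<in> carrier P" "b \<in> carrier P" "g \<in> carrier (G u)"
      "g \<noteq> \<one>\<^bsub>G u\<^esub>" "b = a \<otimes>\<^bsub>P\<^esub> incl u g"
    using ab by (rule stepE)
  obtain h where h: "v \<in> verts \<Gamma>" "h \<in> carrier (G v)" "h \<noteq> \<one>\<^bsub>G v\<^esub>" "c = b \<otimes>\<^bsub>P\<^esub> incl v h"
      "c \<in> carrier P"
    using bc by (rule stepE)
  obtain k where k: "w \<in> verts \<Gamma>" "k \<in> carrier (G w)" "d = c \<otimes>\<^bsub>P\<^esub> incl w k"
    using cd by (rule stepE)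
  let ?a = "inv\<^bsub>P\<^esub> a"
  have "gate u (?a \<otimes>\<^bsub>P\<^esub> b) = g"
    using g by (simp add: P.inv_cancel_left gate_incl)
  then have c: "gate u (?a \<otimes>\<^bsub>P\<^esub> c) = g"
    using gate_step[OF g(1) _ bc, of ?a] uv g(2) by simp
  have "gate u (?a \<otimes>\<^bsub>P\<^esub> d) = \<one>\<^bsub>G u\<^esub>"
    using gate_step[OF g(1) _ da, of ?a] zu g(1,2) by (simp add: gate_one)
  then have "gate u (?a \<otimes>\<^bsub>P\<^esub> c \<otimes>\<^bsub>P\<^esub> incl w k) \<noteq> gate u (?a \<otimes>\<^bsub>P\<^esub> c)"
    using c g(2,5) h(5) k by (simp add: P.m_assoc)
  then have "w = u" and "?a \<otimes>\<^bsub>P\<^esub> c \<in> parabolic (star u)"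
    using g(1,2) h(5) k by (auto simp: gate_mult split: if_splits)
  then have "incl u g \<otimes>\<^bsub>P\<^esub> incl v h \<in> parabolic (star u)"
    using g h by (simp add: P.m_assoc P.inv_cancel_left)
  then have "incl v h \<in> parabolic (star u)"
    using g h by (simp add: parabolic_cancel_left incl_in_parabolic)
  then have "v \<in> star u"
    by (rule incl_in_parabolicD[OF h(1) star_subset[OF g(1)] h(2,3)])
  then show ?thesis using uv \<open>w = u\<close> by (auto simp: star_def)
qed

text \<open>
  Two consecutive sides of an induced square belong to different vertex groups, since otherwise they
  would span a diagonal. Hence \<open>square_step\<close> applies, once from \<open>a\<close> and once from \<open>b\<close>.
\<close>

lemma squareE:
  assumes "square X Q"
  obtains u v a b c d where "Q = {a, b, c, d}" "{u, v} \<in> edges \<Gamma>"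
    "step u a b" "step v b c" "step u c d" "step v d a"
    "\<And>e. e \<in> sides X Q \<Longrightarrow> e = {a, b} \<or> e = {b, c} \<or> e = {c, d} \<or> e = {d, a}"
proof -
  obtain a b c d where Q: "Q = {a, b, c, d}"
    and n: "a \<noteq> c" "b \<noteq> d" "{a, c} \<notin> edges X" "{b, d} \<notin> edges X"
    and e: "{a, b} \<in> edges X" "{b, c} \<in> edges X" "{c, d} \<in> edges X" "{d, a} \<in> edges X"
    using assms unfolding square_iff[OF simplicial_cayley] by blast
  obtain u v w z where s: "step u a b" "step v b c" "step w c d" "step z d a"
    using e unfolding edge_iff_step by blast
  have "u \<noteq> v"
    using step_trans[OF s(1), of c] s(2) n(1,3) by (auto simp: edge_iff_step)
  moreover have "v \<noteq> w"
    using step_trans[OF s(2), of d] s(3) n(2,4) by (auto simp: edge_iff_step)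
  moreover have "z \<noteq> u"
    using step_trans[OF s(4), of b] s(1) n(2,4) by (auto simp: edge_iff_step dest: step_sym)
  ultimately have "w = u \<and> {u, v} \<in> edges \<Gamma>" "z = v"
    using square_step[OF s] square_step[OF s(2-4) s(1)] by fast+
  then show thesis
    using s sides_square[OF simplicial_cayley n(3,4)] Q by (intro that[OF Q, of u v]) simp_all
qed

lemma square_of_commuting:
  assumes uv: "{u, v} \<in> edges \<Gamma>" and ab: "step u a b" and ad: "step v a d"
  obtains c where "square X {a, b, c, d}" "step v b c" "step u d c"
proof -
  obtain g where g: "u \<in> verts \<Gamma>" "a \<in> carrier P" "b \<in> carrier P" "g \<in> carrier (G u)"
      "g \<noteq> \<one>\<^bsub>G u\<^esub>" "b = a \<otimes>\<^bsub>P\<^esub> incl u g"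
    using ab by (rule stepE)
  obtain h where h: "v \<in> verts \<Gamma>" "h \<in> carrier (G v)" "h \<noteq> \<one>\<^bsub>G v\<^esub>" "d = a \<otimes>\<^bsub>P\<^esub> incl v h"
      "d \<in> carrier P"
    using ad by (rule stepE)
  define c where "c = b \<otimes>\<^bsub>P\<^esub> incl v h"
  have bc: "step v b c"
    using g h by (auto simp: c_def intro: stepI)
  have "c = d \<otimes>\<^bsub>P\<^esub> incl u g"
    using g h incl_commute[OF uv, of g h] by (simp add: c_def P.m_assoc)
  then have dc: "step u d c"
    using g h by (auto intro: stepI)
  have neq: "u \<noteq> v" using edge_verts[OF uv] by simp
  have "{a, c} \<notin> edges X" "{b, d} \<notin> edges X"
    using triangle_step[OF ab bc] triangle_step[OF step_sym[OF ab] ad] neq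
    by (auto simp: edge_iff_step)
  moreover have "a \<noteq> c" "b \<noteq> d"
    using step_unique[OF step_sym[OF ab]] step_unique[OF ab] bc ad neq by auto
  moreover have "{a, b} \<in> edges X" "{b, c} \<in> edges X" "{c, d} \<in> edges X" "{d, a} \<in> edges X"
    using ab bc step_sym[OF dc] step_sym[OF ad] by (auto simp: edge_iff_step)
  ultimately have "square X {a, b, c, d}"
    unfolding square_iff[OF simplicial_cayley] by blast
  then show thesis using that bc dc by blast
qed

section \<open>Hyperplanes\<close>

definition wall :: "('v \<times> 'g) list set set set \<Rightarrow> ('v \<times> 'g) list set set set set" where
  "wall A = {{p, q} | p q v. step v p q \<and> conj_vg p v = A}"

lemma conj_vg_step_self: "step v p q \<Longrightarrow> conj_vg p v = conj_vg q v"
  by (rule conj_vg_step) (auto elim: stepE)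

lemma wallI: "step v p q \<Longrightarrow> {p, q} \<in> wall (conj_vg p v)"
  by (auto simp: wall_def)

lemma in_wall_iff: "{p, q} \<in> wall A \<longleftrightarrow> (\<exists>v. step v p q \<and> conj_vg p v = A)"
  using conj_vg_step_self step_sym by (fastforce simp: wall_def doubleton_eq_iff)

lemma wall_unique:
  assumes "e \<in> wall A" "e \<in> wall B" shows "A = B"
proof -
  obtain p q v where e: "e = {p, q}" "step v p q" "conj_vg p v = A"
    using assms(1) by (auto simp: wall_def)
  obtain w where "step w p q" "conj_vg p w = B"
    using assms(2) unfolding e(1) in_wall_iff by blast
  then show ?thesis using e step_unique by metis
qed

lemma triangle_sides_in_wall:
  assumes "triangle X T"
  shows "\<exists>B. sides X T \<subseteq> wall B"
proof -
  obtain a b c where T: "T = {a, b, c}"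
    and e: "{a, b} \<in> edges X" "{b, c} \<in> edges X" "{a, c} \<in> edges X"
    using assms unfolding triangle_iff[OF simplicial_cayley] by blast
  obtain u v w where "step u a b" "step v b c" "step w a c"
    using e unfolding edge_iff_step by blast
  then have s: "step u a b" "step u b c" "step u a c" using triangle_step by blast+
  have "e \<in> wall (conj_vg a u)" if "e \<in> sides X T" for e
  proof -
    have "e \<in> edges X" "e \<subseteq> T" using that by (simp_all add: induced_subgraph_def)
    then obtain x y z where "step z x y" "e = {x, y}" by (auto simp: edges_cayley)
    then have "e = {x, y}" "x \<noteq> y" "x \<in> T" "y \<in> T"
      using step_neq \<open>e \<subseteq> T\<close> by auto
    moreover have "{a, b} \<in> wall (conj_vg a u)" "{b, c} \<in> wall (conj_vg a u)"
        "{a, c} \<in> wall (conj_vg a u)"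
      using s conj_vg_step_self[OF s(1)] by (auto simp: in_wall_iff)
    ultimately show ?thesis unfolding T by (auto simp: insert_commute)
  qed
  then show ?thesis by blast
qed

lemma opposite_sides_in_wall:
  assumes "{u, v} \<in> edges \<Gamma>" "step u a b" "step v b c" "step u c d" "step v d a"
  shows "{a, b} \<in> wall (conj_vg a u)" "{c, d} \<in> wall (conj_vg a u)"
    "{b, c} \<in> wall (conj_vg a v)" "{d, a} \<in> wall (conj_vg a v)"
proof -
  have uv: "u \<in> verts \<Gamma>" "v \<in> verts \<Gamma>" "u \<in> star v" "v \<in> star u"
    using assms(1) edge_verts by (auto simp: star_def insert_commute)
  have "conj_vg c u = conj_vg a u"
    using conj_vg_step[OF assms(3)] conj_vg_step_self[OF assms(2)] uv
      conj_vg_step[OF assms(5)] conj_vg_step_self[OF assms(4)] by simp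
  moreover have "conj_vg b v = conj_vg a v"
    using conj_vg_step[OF assms(2)] uv by simp
  moreover have "conj_vg d v = conj_vg a v"
    using conj_vg_step_self[OF assms(5)] by simp
  ultimately show "{a, b} \<in> wall (conj_vg a u)" "{c, d} \<in> wall (conj_vg a u)"
    "{b, c} \<in> wall (conj_vg a v)" "{d, a} \<in> wall (conj_vg a v)"
    using assms(2-) unfolding in_wall_iff by blast+
qed

lemma elementary_parallel_wall:
  assumes "(e, f) \<in> elementary_parallel X" "e \<in> wall A"
  shows "f \<in> wall A"
proof -
  have "\<exists>B. e \<in> wall B \<and> f \<in> wall B"
  proof -
    consider T where "triangle X T" "e \<in> sides X T" "f \<in> sides X T"
      | Q where "square X Q" "e \<in> sides X Q" "f \<in> sides X Q" "e \<inter> f = {}"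
      using assms(1) unfolding elementary_parallel_def by blast
    then show ?thesis
    proof cases
      case 1
      then show ?thesis using triangle_sides_in_wall by blast
    next
      case 2
      from 2(1) show ?thesis
      proof (rule squareE)
        fix u v a b c d
        assume *: "{u, v} \<in> edges \<Gamma>" "step u a b" "step v b c" "step u c d" "step v d a"
          and s: "\<And>e. e \<in> sides X Q \<Longrightarrow> e = {a, b} \<or> e = {b, c} \<or> e = {c, d} \<or> e = {d, a}"
        show ?thesis
          using s[OF 2(2)] s[OF 2(3)]
            2(4) opposite_sides_in_wall[OF *] by auto
      qed
    qed
  qed
  then show ?thesis using assms(2) wall_unique by blast
qed

text \<open>
  Unless they are equal, the two edges are sides of a triangle in a coset of the vertex group.
\<close>

lemma elementary_parallel_common_vertex:
  assumes "step v p q" "step v p r"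
  shows "({p, q}, {p, r}) \<in> (elementary_parallel X)\<^sup>*"
proof (cases "q = r")
  case False
  have "step v q r" using assms step_sym step_trans False by blast
  then have "triangle X {p, q, r}"
    using assms unfolding triangle_iff[OF simplicial_cayley] by (auto simp: edge_iff_step)
  moreover have "{p, q} \<in> sides X {p, q, r}" "{p, r} \<in> sides X {p, q, r}"
    using assms by (auto simp: induced_subgraph_def edge_iff_step)
  ultimately have "({p, q}, {p, r}) \<in> elementary_parallel X"
    unfolding elementary_parallel_def by blast
  then show ?thesis by blast
qed simp

lemma elementary_parallel_opposite:
  assumes "square X {a, b, c, d}" "{a, b} \<in> edges X" "{d, c} \<in> edges X" "{a, b} \<inter> {d, c} = {}"
  shows "({a, b}, {d, c}) \<in> elementary_parallel X"
proof -
  have "{a, b} \<in> sides X {a, b, c, d}" "{d, c} \<in> sides X {a, b, c, d}"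
    using assms(2,3) by (simp_all add: induced_subgraph_def)
  then show ?thesis using assms(1,4) unfolding elementary_parallel_def by blast
qed

text \<open>
  Moving a side along an edge from the same vertex group uses triangles in the clique; moving it along
  an edge from an adjacent vertex group uses the square spanned by both.
\<close>

lemma star_parallel:
  assumes v: "v \<in> verts \<Gamma>" and "h \<in> parabolic (star v)"
    and "step v p q" "step v (p \<otimes>\<^bsub>P\<^esub> h) r"
  shows "({p, q}, {p \<otimes>\<^bsub>P\<^esub> h, r}) \<in> (elementary_parallel X)\<^sup>*"
  using star_subset[OF v] assms(2-)
proof (induction arbitrary: p q r rule: parabolic_induct)
  case one
  then have "p \<in> carrier P" by (auto elim: stepE)
  then show ?case using one elementary_parallel_common_vertex by simp
next
  case (incl w t)
  have w: "w \<in> verts \<Gamma>" using incl(1) star_subset[OF v] by blast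
  have p: "p \<in> carrier P" using incl by (auto elim: stepE)
  let ?z = "p \<otimes>\<^bsub>P\<^esub> incl w t"
  show ?case
  proof (cases "t = \<one>\<^bsub>G w\<^esub>")
    case True
    then show ?thesis using incl w p elementary_parallel_common_vertex by simp
  next
    case False
    then have pz: "step w p ?z" using stepI w p incl by blast
    show ?thesis
    proof (cases "w = v")
      case True
      have "({p, q}, {p, ?z}) \<in> (elementary_parallel X)\<^sup>*"
        using incl(3) pz True by (simp add: elementary_parallel_common_vertex)
      moreover have "({?z, p}, {?z, r}) \<in> (elementary_parallel X)\<^sup>*"
        using incl(4) step_sym[OF pz] True by (simp add: elementary_parallel_common_vertex)
      ultimately show ?thesis by (simp add: insert_commute[of ?z p])
    next
      case False
      then have vw: "{v, w} \<in> edges \<Gamma>" using incl(1) by (auto simp: star_def)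
      obtain c where c: "square X {p, q, c, ?z}" "step w q c" "step v ?z c"
        using square_of_commuting[OF vw incl(3) pz] by blast
      have "{p, q} \<inter> {?z, c} = {}"
        using step_neq[OF pz] step_neq[OF c(2)] step_unique[OF incl(3)] step_unique[OF step_sym[OF incl(3)]]
          pz c(2) False by auto
      then have "({p, q}, {?z, c}) \<in> elementary_parallel X"
        using c incl(3) by (intro elementary_parallel_opposite) (auto simp: edge_iff_step)
      then show ?thesis
        using elementary_parallel_common_vertex[OF c(3) incl(4)] by (rule converse_rtrancl_into_rtrancl)
    qed
  qed
next
  case (mult h k)
  have cl: "p \<in> carrier P" "h \<in> carrier P" "k \<in> carrier P"
    using mult parabolic_closed[OF star_subset[OF v]] by (auto elim: stepE)
  obtain s where s: "step v (p \<otimes>\<^bsub>P\<^esub> h) s" using step_exists v cl by (metis P.m_closed)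
  have "({p, q}, {p \<otimes>\<^bsub>P\<^esub> h, s}) \<in> (elementary_parallel X)\<^sup>*"
    using mult.IH(1) mult.prems(1) s by blast
  also have "({p \<otimes>\<^bsub>P\<^esub> h, s}, {p \<otimes>\<^bsub>P\<^esub> h \<otimes>\<^bsub>P\<^esub> k, r}) \<in> (elementary_parallel X)\<^sup>*"
    using mult.IH(2)[OF s] mult.prems(2) cl by (simp add: P.m_assoc)
  finally show ?case using cl by (simp add: P.m_assoc)
qed

text \<open>
  Every wall is one hyperplane: labels are invariant under elementary parallelism, and by the
  computation of normalizers two edges with equal label satisfy the hypothesis of \<open>star_parallel\<close>.
\<close>

lemma wall_eq_class:
  assumes "e \<in> wall A"
  shows "(elementary_parallel X)\<^sup>* `` {e} = wall A"
proof (intro equalityI subsetI)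
  fix f assume "f \<in> (elementary_parallel X)\<^sup>* `` {e}"
  then have "(e, f) \<in> (elementary_parallel X)\<^sup>*" by simp
  then show "f \<in> wall A"
    by (induction rule: rtrancl_induct) (auto intro: assms elementary_parallel_wall)
next
  fix f assume "f \<in> wall A"
  then obtain w p' q' where f: "f = {p', q'}" "step w p' q'" "conj_vg p' w = A"
    by (auto simp: wall_def)
  obtain v p q where e: "e = {p, q}" "step v p q" "conj_vg p v = A"
    using assms by (auto simp: wall_def)
  have cl: "p \<in> carrier P" "p' \<in> carrier P" "v \<in> verts \<Gamma>" "w \<in> verts \<Gamma>"
    using e(2) f(2) by (auto elim: stepE)
  then have "v = w" "inv\<^bsub>P\<^esub> p \<otimes>\<^bsub>P\<^esub> p' \<in> parabolic (star v)"
    using e(3) f(3) conj_vg_eq_iff[of p v p' w] by auto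
  then have "({p, q}, {p \<otimes>\<^bsub>P\<^esub> (inv\<^bsub>P\<^esub> p \<otimes>\<^bsub>P\<^esub> p'), q'}) \<in> (elementary_parallel X)\<^sup>*"
    using e(2) f(2) cl by (intro star_parallel[of v]) (auto simp: P.inv_cancel_left)
  then show "f \<in> (elementary_parallel X)\<^sup>* `` {e}"
    using e(1) f(1) cl by (simp add: P.inv_cancel_left)
qed

lemma wall_subset_edges: "wall A \<subseteq> edges X"
proof
  fix e assume "e \<in> wall A"
  then obtain p q v where "step v p q" "e = {p, q}" by (auto simp: wall_def)
  then show "e \<in> edges X" unfolding edges_cayley by blast
qed

lemma extension_vertsE:
  assumes "A \<in> extension_verts \<Gamma> G"
  obtains p v where "p \<in> carrier P" "v \<in> verts \<Gamma>" "A = conj_vg p v"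
  using assms by (auto simp: extension_verts_def)

lemma conj_vg_in_extension_verts:
  "p \<in> carrier P \<Longrightarrow> v \<in> verts \<Gamma> \<Longrightarrow> conj_vg p v \<in> extension_verts \<Gamma> G"
  by (auto simp: extension_verts_def)

lemma wall_nonempty:
  assumes "A \<in> extension_verts \<Gamma> G"
  obtains e where "e \<in> wall A"
  using assms by (metis extension_vertsE step_exists wallI)

lemma hyperplanes_eq: "hyperplanes X = wall ` extension_verts \<Gamma> G"
proof (intro equalityI subsetI)
  fix J assume "J \<in> hyperplanes X"
  then obtain e where "e \<in> edges X" and J: "J = (elementary_parallel X)\<^sup>* `` {e}"
    by (auto simp: hyperplanes_def quotient_def)
  then obtain v p q where "step v p q" "e = {p, q}" by (auto simp: edges_cayley)
  then have "e \<in> wall (conj_vg p v)" "conj_vg p v \<in> extension_verts \<Gamma> G"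
    by (auto intro: wallI conj_vg_in_extension_verts elim: stepE)
  then show "J \<in> wall ` extension_verts \<Gamma> G" using wall_eq_class J by blast
next
  fix J assume "J \<in> wall ` extension_verts \<Gamma> G"
  then obtain A where A: "A \<in> extension_verts \<Gamma> G" "J = wall A" by blast
  obtain e where e: "e \<in> wall A" using wall_nonempty[OF A(1)] .
  then show "J \<in> hyperplanes X"
    using quotientI[OF subsetD[OF wall_subset_edges e], of "(elementary_parallel X)\<^sup>*"]
    by (simp add: hyperplanes_def wall_eq_class[OF e] A(2))
qed

lemma inj_on_wall: "inj_on wall (extension_verts \<Gamma> G)"
  by (rule inj_onI) (metis wall_nonempty wall_unique)

lemma left_translate_wall_subset:
  assumes p: "p \<in> carrier P"
  shows "left_translate P p (wall A) \<subseteq> wall (conjugate P p A)"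
proof -
  have "p <#\<^bsub>P\<^esub> {q, r} \<in> wall (conjugate P p (conj_vg q v))" if "step v q r" for q r v
  proof -
    have "p <#\<^bsub>P\<^esub> {q, r} = {p \<otimes>\<^bsub>P\<^esub> q, p \<otimes>\<^bsub>P\<^esub> r}" by (auto simp: l_coset_def)
    moreover have "conjugate P p (conj_vg q v) = conj_vg (p \<otimes>\<^bsub>P\<^esub> q) v"
      using that p by (auto simp: conj_vg_mult elim: stepE)
    ultimately show ?thesis using wallI[OF step_translate[OF p that]] by simp
  qed
  then show ?thesis by (auto simp: left_translate_def wall_def[of A])
qed

text \<open>
  One inclusion holds for every group element; the other one is the first for the inverse element.
\<close>

lemma wall_conjugate:
  assumes p: "p \<in> carrier P" and A: "A \<in> extension_verts \<Gamma> G"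
  shows "wall (conjugate P p A) = left_translate P p (wall A)"
proof
  show "left_translate P p (wall A) \<subseteq> wall (conjugate P p A)"
    by (rule left_translate_wall_subset[OF p])
next
  obtain q v where qv: "q \<in> carrier P" "v \<in> verts \<Gamma>" "A = conj_vg q v"
    using A by (rule extension_vertsE)
  have "conjugate P (inv\<^bsub>P\<^esub> p) (conjugate P p A) = A"
    using p qv by (simp add: conj_vg_mult P.inv_cancel_left)
  then have "left_translate P (inv\<^bsub>P\<^esub> p) (wall (conjugate P p A)) \<subseteq> wall A"
    using left_translate_wall_subset[of "inv\<^bsub>P\<^esub> p" "conjugate P p A"] p by simp
  moreover have "p <#\<^bsub>P\<^esub> (inv\<^bsub>P\<^esub> p <#\<^bsub>P\<^esub> e) = e" if "e \<in> wall (conjugate P p A)" for e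
  proof -
    have "e \<subseteq> carrier P" using that by (auto simp: wall_def elim: stepE)
    then show ?thesis using p by (simp add: P.lcos_m_assoc P.lcos_mult_one)
  qed
  ultimately show "wall (conjugate P p A) \<subseteq> left_translate P p (wall A)"
    unfolding left_translate_def image_subset_iff by (intro subsetI) (rule image_eqI[OF HOL.sym], auto)
qed

lemma adjacent_conjugates_commute:
  assumes uv: "{u, v} \<in> edges \<Gamma>" and p: "p \<in> carrier P" and "a \<in> conj_vg p u" "b \<in> conj_vg p v"
  shows "a \<otimes>\<^bsub>P\<^esub> b = b \<otimes>\<^bsub>P\<^esub> a"
proof -
  have *: "u \<in> verts \<Gamma>" "v \<in> verts \<Gamma>" using edge_verts[OF uv] by auto
  obtain g h where g: "g \<in> carrier (G u)" "a = p \<otimes>\<^bsub>P\<^esub> incl u g \<otimes>\<^bsub>P\<^esub> inv\<^bsub>P\<^esub> p"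
    and h: "h \<in> carrier (G v)" "b = p \<otimes>\<^bsub>P\<^esub> incl v h \<otimes>\<^bsub>P\<^esub> inv\<^bsub>P\<^esub> p"
    using assms(3,4) p * by (auto simp: conj_vg_eq)
  have "a \<otimes>\<^bsub>P\<^esub> b = p \<otimes>\<^bsub>P\<^esub> (incl u g \<otimes>\<^bsub>P\<^esub> incl v h) \<otimes>\<^bsub>P\<^esub> inv\<^bsub>P\<^esub> p"
    using g h p * by (simp add: P.m_assoc P.inv_cancel_left)
  also have "\<dots> = b \<otimes>\<^bsub>P\<^esub> a"
    using g h p * by (simp add: incl_commute[OF uv]) (simp add: P.m_assoc P.inv_cancel_left)
  finally show ?thesis .
qed

text \<open>
  A square carries exactly two labels, and they are conjugates of adjacent vertex groups by the same
  element. Conversely, commuting conjugates have this form by \<open>commuting_conjugates\<close> and span a square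
  at the common base point.
\<close>

lemma walls_cross_iff:
  assumes "A \<in> extension_verts \<Gamma> G" "B \<in> extension_verts \<Gamma> G" "A \<noteq> B"
  shows "(\<exists>Q. square X Q \<and> sides X Q \<inter> wall A \<noteq> {} \<and> sides X Q \<inter> wall B \<noteq> {}) \<longleftrightarrow>
    (\<forall>a\<in>A. \<forall>b\<in>B. a \<otimes>\<^bsub>P\<^esub> b = b \<otimes>\<^bsub>P\<^esub> a)"
proof
  assume "\<exists>Q. square X Q \<and> sides X Q \<inter> wall A \<noteq> {} \<and> sides X Q \<inter> wall B \<noteq> {}"
  then obtain Q e f where Q: "square X Q" and e: "e \<in> sides X Q" "e \<in> wall A"
    and f: "f \<in> sides X Q" "f \<in> wall B"
    by blast
  from Q show "\<forall>a\<in>A. \<forall>b\<in>B. a \<otimes>\<^bsub>P\<^esub> b = b \<otimes>\<^bsub>P\<^esub> a"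
  proof (rule squareE)
    fix u v a b c d
    assume *: "{u, v} \<in> edges \<Gamma>" "step u a b" "step v b c" "step u c d" "step v d a"
      and s: "\<And>e. e \<in> sides X Q \<Longrightarrow> e = {a, b} \<or> e = {b, c} \<or> e = {c, d} \<or> e = {d, a}"
    have "C = conj_vg a u \<or> C = conj_vg a v" if "e \<in> sides X Q" "e \<in> wall C" for e C
      using s[OF that(1)] that(2) opposite_sides_in_wall[OF *] wall_unique by metis
    then have "A = conj_vg a u \<and> B = conj_vg a v \<or> A = conj_vg a v \<and> B = conj_vg a u"
      using e f assms(3) by blast
    moreover have "a \<in> carrier P" using *(2) by (rule stepE)
    ultimately show ?thesis
      using adjacent_conjugates_commute[OF *(1)] by metis
  qed
next
  assume comm: "\<forall>a\<in>A. \<forall>b\<in>B. a \<otimes>\<^bsub>P\<^esub> b = b \<otimes>\<^bsub>P\<^esub> a"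
  obtain p v where A: "p \<in> carrier P" "v \<in> verts \<Gamma>" "A = conj_vg p v"
    using assms(1) by (rule extension_vertsE)
  obtain q w where B: "q \<in> carrier P" "w \<in> verts \<Gamma>" "B = conj_vg q w"
    using assms(2) by (rule extension_vertsE)
  obtain a where a: "a \<in> carrier P" "{v, w} \<in> edges \<Gamma>" "A = conj_vg a v" "B = conj_vg a w"
    using commuting_conjugates[OF A(1,2) B(1,2)] assms(3) comm A(3) B(3) by metis
  obtain b where b: "step v a b" using step_exists[OF A(2) a(1)] .
  obtain d where d: "step w a d" using step_exists[OF B(2) a(1)] .
  obtain c where c: "square X {a, b, c, d}" using square_of_commuting[OF a(2) b d] .
  have "{a, b} \<in> sides X {a, b, c, d} \<inter> wall A" "{a, d} \<in> sides X {a, b, c, d} \<inter> wall B"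
    using wallI[OF b] wallI[OF d] a wall_subset_edges by (auto simp: induced_subgraph_def)
  then show "\<exists>Q. square X Q \<and> sides X Q \<inter> wall A \<noteq> {} \<and> sides X Q \<inter> wall B \<noteq> {}"
    using c by blast
qed

text \<open>
  Both endpoints of an edge give the same label, so the endpoints of a wall are the base points from
  which its label is a conjugate of a vertex group. This turns contact into the existence of a common
  translate.
\<close>

lemma endpoints_wall:
  "hyperplane_endpoints (wall A) = {p \<in> carrier P. \<exists>v\<in>verts \<Gamma>. A = conj_vg p v}"
proof (intro equalityI subsetI)
  fix r assume "r \<in> hyperplane_endpoints (wall A)"
  then obtain p q v where s: "step v p q" "conj_vg p v = A" "r = p \<or> r = q"
    by (auto simp: hyperplane_endpoints_def wall_def)
  moreover have "p \<in> carrier P" "q \<in> carrier P" "v \<in> verts \<Gamma>" using s(1) by (auto elim: stepE)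
  ultimately show "r \<in> {p \<in> carrier P. \<exists>v\<in>verts \<Gamma>. A = conj_vg p v}"
    using conj_vg_step_self[OF s(1)] by auto
next
  fix r assume "r \<in> {p \<in> carrier P. \<exists>v\<in>verts \<Gamma>. A = conj_vg p v}"
  then obtain v where r: "r \<in> carrier P" "v \<in> verts \<Gamma>" "A = conj_vg r v" by blast
  obtain q where "step v r q" using step_exists[OF r(2,1)] .
  then have "{r, q} \<in> wall A" using wallI r(3) by blast
  then show "r \<in> hyperplane_endpoints (wall A)"
    by (auto simp: hyperplane_endpoints_def)
qed

lemma walls_contact_iff:
  "hyperplane_endpoints (wall A) \<inter> hyperplane_endpoints (wall B) \<noteq> {} \<longleftrightarrow>
     (\<exists>p\<in>carrier P. {A, B} \<subseteq> translate_verts \<Gamma> G p)"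
  by (auto simp: endpoints_wall translate_verts_def)

lemma wall_bij: "bij_betw wall (extension_verts \<Gamma> G) (hyperplanes X)"
  by (simp add: bij_betw_def inj_on_wall hyperplanes_eq)

lemma wall_crossing: "graph_isomorphism wall (extension_graph \<Gamma> G) (crossing_graph X)"
proof -
  have "{A, B} \<in> edges (extension_graph \<Gamma> G) \<longleftrightarrow> {wall A, wall B} \<in> edges (crossing_graph X)"
    if AB: "A \<in> extension_verts \<Gamma> G" "B \<in> extension_verts \<Gamma> G" for A B
  proof -
    have "{A, B} \<in> edges (extension_graph \<Gamma> G) \<longleftrightarrow>
        A \<noteq> B \<and> (\<forall>a\<in>A. \<forall>b\<in>B. a \<otimes>\<^bsub>P\<^esub> b = b \<otimes>\<^bsub>P\<^esub> a)"
      using AB by (auto simp: extension_graph_def doubleton_eq_iff)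
    moreover have "{wall A, wall B} \<in> edges (crossing_graph X) \<longleftrightarrow> wall A \<noteq> wall B \<and>
        (\<exists>Q. square X Q \<and> sides X Q \<inter> wall A \<noteq> {} \<and> sides X Q \<inter> wall B \<noteq> {})"
      using bij_betwE[OF wall_bij] AB unfolding crossing_graph_edge_iff by blast
    ultimately show ?thesis
      using walls_cross_iff[OF AB] inj_on_eq_iff[OF inj_on_wall AB] by blast
  qed
  then show ?thesis
    using wall_bij by (simp add: graph_isomorphism_def extension_graph_def crossing_graph_def)
qed

lemma wall_contact: "graph_isomorphism wall (coned_off_extension_graph \<Gamma> G) (contact_graph X)"
proof -
  have "{A, B} \<in> edges (coned_off_extension_graph \<Gamma> G) \<longleftrightarrow> {wall A, wall B} \<in> edges (contact_graph X)"
    if AB: "A \<in> extension_verts \<Gamma> G" "B \<in> extension_verts \<Gamma> G" for A B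
  proof -
    have "{A, B} \<in> edges (coned_off_extension_graph \<Gamma> G) \<longleftrightarrow>
        A \<noteq> B \<and> (\<exists>p\<in>carrier P. {A, B} \<subseteq> translate_verts \<Gamma> G p)"
      using AB by (auto simp: coned_off_extension_graph_def doubleton_eq_iff)
    moreover have "{wall A, wall B} \<in> edges (contact_graph X) \<longleftrightarrow> wall A \<noteq> wall B \<and>
        hyperplane_endpoints (wall A) \<inter> hyperplane_endpoints (wall B) \<noteq> {}"
      using bij_betwE[OF wall_bij] AB unfolding contact_graph_edge_iff by blast
    ultimately show ?thesis
      using walls_contact_iff[of A B] inj_on_eq_iff[OF inj_on_wall AB] by blast
  qed
  then show ?thesis
    using wall_bij by (simp add: graph_isomorphism_def coned_off_extension_graph_def contact_graph_def)
qed

end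

theorem proposition3p19:
  fixes \<Gamma> :: "'v sgraph"
    and G :: "'v \<Rightarrow> ('g, 'b) monoid_scheme"
    and X :: "('v \<times> 'g) list set set sgraph"
  assumes "simplicial_graph \<Gamma>"
    and "\<And>v. v \<in> verts \<Gamma> \<Longrightarrow> group (G v)"
    and "\<And>v. v \<in> verts \<Gamma> \<Longrightarrow> carrier (G v) \<noteq> {\<one>\<^bsub>G v\<^esub>}"
    and "X = cayley_graph (graph_product \<Gamma> G) (graph_product_generators \<Gamma> G)"
  shows "\<exists>F. bij_betw F (verts (extension_graph \<Gamma> G)) (hyperplanes X) \<and>
    (\<forall>p\<in>carrier (graph_product \<Gamma> G). \<forall>A\<in>verts (extension_graph \<Gamma> G).
       F (conjugate (graph_product \<Gamma> G) p A) = left_translate (graph_product \<Gamma> G) p (F A)) \<and>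
    graph_isomorphism F (extension_graph \<Gamma> G) (crossing_graph X) \<and>
    graph_isomorphism F (coned_off_extension_graph \<Gamma> G) (contact_graph X)"
proof -
  interpret nontrivial_graph_of_groups \<Gamma> G
    by (intro nontrivial_graph_of_groups.intro graph_of_groups.intro group_family.intro
        graph_of_groups_axioms.intro nontrivial_graph_of_groups_axioms.intro) (use assms in auto)
  have "verts (extension_graph \<Gamma> G) = extension_verts \<Gamma> G" by (simp add: extension_graph_def)
  then show ?thesis
    using wall_bij wall_conjugate wall_crossing wall_contact unfolding assms(4)
    by (intro exI[of _ wall]) simp
qed

end
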